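(* Let $u$ be the viscosity solution of the boundary value problem described in the context, and let $(t_0,x_0)\in\Sigma(u)$ be a singular point of $u$. Then there exist $T\in(0,+\infty]$ and a Lipschitz continuous arc $\gamma:[t_0,t_0+T)\to\mathbb{R}^n$ with $\gamma(t_0)=x_0$ such that $$(s,\gamma(s))\in\Sigma(u)\qquad\text{for all } s\in[t_0,t_0+T),$$ and such that $\lim_{s\to t_0+T}\gamma(s)\in\partial\Omega$ whenever $T<+\infty$.
   Context: Setting. $\Omega\subset\mathbb{R}^n$ is an open set, $Q=(0,+\infty)\times\Omega\subset\mathbb{R}^{n+1}$. $A$ is a symmetric positive definite real $n\times n$ matrix, $H(p)=\frac12 Ap\cdot p$ for $p\in\mathbb{R}^n$, and $L(q)=\frac12A^{-1}q\cdot q$ is its Legendre transform. $\varphi:\overline Q\to\mathbb{R}$ is Lipschitz continuous and satisfies the compatibility condition $$\varphi(t,x)-\varphi(s,y)\le (t-s)L\left(\frac{x-y}{t-s}\right)\quad\text{for all }(t,x),(s,y)\in\partial Q\text{ with }t>s\ge0.$$ $u\in \mathrm{Lip}(\overline Q)$ is the unique viscosity solution of $u_t+H(\nabla u)=0$ in $Q$, $u=\varphi$ on $\partial Q$ (here $\nabla$ is the gradient in $x$); it is given by the Hopf formula $$u(t,x)=\min_{(s,y)\in\partial Q,\ s<t}\left[(t-s)L\left(\frac{x-y}{t-s}\right)+\varphi(s,y)\right],\quad (t,x)\in Q.$$ Equivalently, $u$ is the unique Lipschitz function on $\overline Q$ that is locally semiconcave in $Q$, solves the equation almost everywhere in $Q$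 and equals $\varphi$ on $\partial Q$. Notation. $\Sigma(u)\subset Q$ is the set of points of $Q$ at which $u$ is not differentiable (as a function of $(t,x)$); its elements are called the singular points of $u$. *)

theory Defs
  imports "HOL-Analysis.Analysis"
begin

definition sym_pos_def :: "real^'n^'n \<Rightarrow> bool" where
  "sym_pos_def A \<longleftrightarrow> transpose A = A \<and> (\<forall>x. x \<noteq> 0 \<longrightarrow> 0 < (A *v x) \<bullet> x)"

definition hamiltonian :: "real^'n^'n \<Rightarrow> real^'n \<Rightarrow> real" where
  "hamiltonian A p = 1/2 * ((A *v p) \<bullet> p)"

definition lagrangian :: "real^'n^'n \<Rightarrow> real^'n \<Rightarrow> real" where
  "lagrangian A q = 1/2 * ((matrix_inv A *v q) \<bullet> q)"

definition space_time :: "(real^'n) set \<Rightarrow> (real \<times> (real^'n)) set" where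
  "space_time \<Omega> = {0<..} \<times> \<Omega>"

definition lipschitz_cont_on :: "'a::metric_space set \<Rightarrow> ('a \<Rightarrow> 'b::metric_space) \<Rightarrow> bool" where
  "lipschitz_cont_on S f \<longleftrightarrow> (\<exists>C. C-lipschitz_on S f)"

text \<open>\<open>D z = (\<psi>\<^sub>t z, \<nabla>\<psi> z)\<close> is the space-time gradient of a \<open>C\<^sup>1\<close> function \<open>\<psi>\<close> on
  the open set \<open>Q\<close>.\<close>

definition C1_with_gradient ::
  "(real \<times> (real^'n)) set \<Rightarrow> (real \<times> (real^'n) \<Rightarrow> real) \<Rightarrow> (real \<times> (real^'n) \<Rightarrow> real \<times> (real^'n)) \<Rightarrow> bool"
  where
  "C1_with_gradient Q \<psi> D \<longleftrightarrow>
     (\<forall>z\<in>Q. (\<psi> has_derivative (\<lambda>h. D z \<bullet> h)) (at z)) \<and> continuous_on Q D"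

text \<open>Viscosity sub- and supersolutions of \<open>u\<^sub>t + H(\<nabla>u) = 0\<close> in an open set \<open>Q\<close>: the test
  function touches \<open>u\<close> (up to a constant) from above, respectively from below, at \<open>z\<close>.\<close>

definition viscosity_subsolution ::
  "(real^'n \<Rightarrow> real) \<Rightarrow> (real \<times> (real^'n)) set \<Rightarrow> (real \<times> (real^'n) \<Rightarrow> real) \<Rightarrow> bool" where
  "viscosity_subsolution H Q u \<longleftrightarrow>
     (\<forall>\<psi> D z. C1_with_gradient Q \<psi> D \<and> z \<in> Q \<and>
        (\<forall>\<^sub>F w in nhds z. u w - \<psi> w \<le> u z - \<psi> z) \<longrightarrow> fst (D z) + H (snd (D z)) \<le> 0)"

definition viscosity_supersolution ::
  "(real^'n \<Rightarrow> real) \<Rightarrow> (real \<times> (real^'n)) set \<Rightarrow> (real \<times> (real^'n) \<Rightarrow> real) \<Rightarrow> bool" where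
  "viscosity_supersolution H Q u \<longleftrightarrow>
     (\<forall>\<psi> D z. C1_with_gradient Q \<psi> D \<and> z \<in> Q \<and>
        (\<forall>\<^sub>F w in nhds z. u w - \<psi> w \<ge> u z - \<psi> z) \<longrightarrow> fst (D z) + H (snd (D z)) \<ge> 0)"

definition viscosity_solution ::
  "(real^'n \<Rightarrow> real) \<Rightarrow> (real \<times> (real^'n)) set \<Rightarrow> (real \<times> (real^'n) \<Rightarrow> real) \<Rightarrow> bool" where
  "viscosity_solution H Q u \<longleftrightarrow>
     continuous_on Q u \<and> viscosity_subsolution H Q u \<and> viscosity_supersolution H Q u"

definition compatible ::
  "(real^'n \<Rightarrow> real) \<Rightarrow> (real \<times> (real^'n)) set \<Rightarrow> (real \<times> (real^'n) \<Rightarrow> real) \<Rightarrow> bool" where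
  "compatible L Q \<phi> \<longleftrightarrow>
     (\<forall>t x s y. (t, x) \<in> frontier Q \<and> (s, y) \<in> frontier Q \<and> t > s \<and> s \<ge> 0 \<longrightarrow>
        \<phi> (t, x) - \<phi> (s, y) \<le> (t - s) * L ((x - y) /\<^sub>R (t - s)))"

definition singular_set ::
  "(real \<times> (real^'n)) set \<Rightarrow> (real \<times> (real^'n) \<Rightarrow> real) \<Rightarrow> (real \<times> (real^'n)) set" where
  "singular_set Q u = {z \<in> Q. \<not> u differentiable (at z)}"

end

theory Submission imports Defs "HOL-Complex_Analysis.Great_Picard" begin

text \<open>Write \<open>L\<close> for the Lagrangian, a quadratic form whose square root is a norm, and \<open>B\<close> for the bilinear form with
\<open>L v = B v v / 2\<close>. Everything rests on the Hopf-Lax formula in a cylinder inside the domain: for a small fixed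
\<open>a > 0\<close>, \<open>u (t, x)\<close> is the minimum over the velocities \<open>v\<close> of \<open>u (t - a, x - a v) + a L v\<close>. The inequality \<open>\<le>\<close>
comes from the subsolution property (\<open>subsolution_along_segments\<close>), the existence of a minimizer from a local
comparison argument for the supersolution property (\<open>supersolution_hopf_lax_bound\<close>).

By the formula \<open>u\<close> is touched from above at \<open>(t, x)\<close> by one smooth function for each minimizing velocity, and the
spatial gradient of that function is the momentum \<open>B v\<close>. Hence \<open>(t, x)\<close> is a singular point if and only if it has at
least two minimizing velocities. The singularity is measured by the circumradius of the set of minimizing velocities
in the norm given by \<open>L\<close>: the predicate \<open>spread S\<close> says that no set \<open>{v. L (w - v) < S}\<close> contains them all.
This predicate passes to limits of points, because minimizing velocities do.

The core is that the spread cannot vanish in finite time. Given \<open>(t, x)\<close> and a small step \<open>h\<close>, let \<open>y\<close> maximize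
\<open>u (t + h, y) - h L ((y - x) / h)\<close> and let \<open>w = (y - x) / h\<close>. Comparing \<open>u (t, x)\<close> with \<open>u (t + h, y)\<close> by means of the
upper bounds issued from a minimizing velocity \<open>v\<close> at \<open>(t, x)\<close> and from a minimizing velocity \<open>v'\<close> at \<open>(t + h, y)\<close> gives
\<open>(a - h) / (a + h) * L (w - v) \<le> L (w - v')\<close>; for a quadratic Lagrangian the errors of the two upper bounds are
exact multiples of \<open>L (w - v)\<close> and \<open>L (w - v')\<close>, which is what makes this inequality multiplicative
(\<open>defect_comparison\<close>). Since \<open>y\<close> is a maximizer, \<open>w\<close> lies in the convex hull of the velocities \<open>v'\<close>, so that their circumradius is at least their smallest distance from \<open>w\<close>. Therefore one step
multiplies the spread by at least \<open>(a - h) / (a + h)\<close> (\<open>spread_step\<close>), and by Bernoulli's inequality at least one half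
of it is left at all times up to \<open>t + a / 4\<close>, whatever the step.

Letting \<open>h\<close> tend to zero, the discrete trajectories converge to a Lipschitz arc of singular points (\<open>singular_arc\<close>).
The length of its time interval depends only on the distance of \<open>x\<close> from the boundary and on a lower bound for \<open>t\<close>, and
the Lipschitz constant is the same for all arcs. So the arcs can be concatenated, always choosing an extension that is
at least half as long as the longest possible one of length at most one, and the process can stop after a finite time
only at a boundary point of \<open>\<Omega>\<close> (\<open>maximal_lipschitz_arc\<close>).\<close>

section \<open>Quadratic Hamiltonians and their Lagrangians\<close>

locale quadratic_hamiltonian =
  fixes A :: "real^'n^'n"
  assumes spd: "sym_pos_def A"
begin

abbreviation H :: "real^'n \<Rightarrow> real" where "H \<equiv> hamiltonian A"
abbreviation L :: "real^'n \<Rightarrow> real" where "L \<equiv> lagrangian A"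

text \<open>The polarization of the Lagrangian, normalized so that \<open>L v = B v v / 2\<close>; \<open>B v\<close> is the momentum that belongs to the
velocity \<open>v\<close>.\<close>
definition B :: "real^'n \<Rightarrow> real^'n \<Rightarrow> real" where
  "B v w = (matrix_inv A *v v) \<bullet> w"

lemma A_symmetric: "(A *v x) \<bullet> y = x \<bullet> (A *v y)"
proof -
  have "transpose A = A" using spd by (simp add: sym_pos_def_def)
  then show ?thesis by (metis dot_lmul_matrix vector_transpose_matrix)
qed

lemma A_inverse: "A *v (matrix_inv A *v x) = x" "matrix_inv A *v (A *v x) = x"
proof -
  have "A *v x = 0 \<Longrightarrow> x = 0" for x
    using spd unfolding sym_pos_def_def by force
  then have "invertible A"
    by (simp add: invertible_left_inverse matrix_left_invertible_ker)
  then have "A ** matrix_inv A = mat 1 \<and> matrix_inv A ** A = mat 1"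
    unfolding invertible_def matrix_inv_def by (rule someI_ex)
  then show "A *v (matrix_inv A *v x) = x" "matrix_inv A *v (A *v x) = x"
    by (simp_all add: matrix_vector_mul_assoc)
qed

lemma L_eq_B: "L v = B v v / 2"
  by (simp add: lagrangian_def B_def)

lemma bilinear_B: "bilinear B"
  unfolding bilinear_def B_def
  by (auto simp: linear_iff matrix_vector_right_distrib inner_add_left inner_add_right matrix_vector_mult_scaleR)

lemma B_add_left: "B (u + v) w = B u w + B v w" and B_add_right: "B u (v + w) = B u v + B u w"
  and B_scale_left: "B (c *\<^sub>R u) v = c * B u v" and B_scale_right: "B u (c *\<^sub>R v) = c * B u v"
  and B_minus_left: "B (- u) v = - B u v" and B_minus_right: "B u (- v) = - B u v"
  and B_diff_left: "B (u - v) w = B u w - B v w" and B_diff_right: "B u (v - w) = B u v - B u w"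
  and B_zero_left: "B 0 v = 0" and B_zero_right: "B u 0 = 0"
  using bilinear_B
  by (auto simp: bilinear_ladd bilinear_radd bilinear_lmul bilinear_rmul bilinear_lneg bilinear_rneg
      bilinear_lsub bilinear_rsub bilinear_lzero bilinear_rzero)

lemmas B_simps = B_add_left B_add_right B_scale_left B_scale_right B_minus_left B_minus_right
  B_diff_left B_diff_right B_zero_left B_zero_right

lemma B_sym: "B v w = B w v"
  by (metis A_inverse(1) A_symmetric B_def inner_commute)

lemma L_zero: "L 0 = 0"
  by (simp add: L_eq_B B_simps)

lemma L_add: "L (v + w) = L v + B v w + L w"
  by (simp add: L_eq_B B_simps B_sym[of w v])

lemma L_scale: "L (c *\<^sub>R v) = c\<^sup>2 * L v"
  by (simp add: L_eq_B B_simps power2_eq_square)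

lemma L_minus: "L (- v) = L v"
  by (simp add: L_eq_B B_simps)

lemma L_diff: "L (v - w) = L v - B v w + L w"
  by (simp add: L_eq_B B_simps B_sym[of w v])

lemma L_pos: "v \<noteq> 0 \<Longrightarrow> 0 < L v"
proof -
  assume "v \<noteq> 0"
  then have "matrix_inv A *v v \<noteq> 0"
    by (metis A_inverse(1) matrix_vector_mult_0_right)
  then have "0 < (A *v (matrix_inv A *v v)) \<bullet> (matrix_inv A *v v)"
    using spd unfolding sym_pos_def_def by blast
  then show ?thesis
    by (simp add: A_inverse lagrangian_def inner_commute)
qed

lemma L_nonneg: "0 \<le> L v"
  using L_pos[of v] L_zero by (cases "v = 0") auto

lemma continuous_B [continuous_intros]:
  "continuous_on S f \<Longrightarrow> continuous_on S g \<Longrightarrow> continuous_on S (\<lambda>x. B (f x) (g x))"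
  unfolding B_def
  by (intro continuous_on_inner bounded_linear.continuous_on[OF matrix_vector_mul_bounded_linear]) auto

lemma continuous_L [continuous_intros]: "continuous_on S f \<Longrightarrow> continuous_on S (\<lambda>x. L (f x))"
  unfolding L_eq_B by (intro continuous_intros) auto

lemma tendsto_B: "(f \<longlongrightarrow> a) F \<Longrightarrow> (g \<longlongrightarrow> b) F \<Longrightarrow> ((\<lambda>x. B (f x) (g x)) \<longlongrightarrow> B a b) F"
  unfolding B_def
  by (intro tendsto_inner bounded_linear.tendsto[OF matrix_vector_mul_bounded_linear]) auto

lemma tendsto_L: "(f \<longlongrightarrow> a) F \<Longrightarrow> ((\<lambda>x. L (f x)) \<longlongrightarrow> L a) F"
  unfolding L_eq_B by (intro tendsto_intros tendsto_B) auto

lemma B_bounded: obtains C where "0 < C" "\<And>v w. \<bar>B v w\<bar> \<le> C * norm v * norm w"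
  using bilinear_bounded_pos[OF bilinear_B] by (metis real_norm_def)

lemma L_coercive: obtains c where "0 < c" "\<And>v. c * (norm v)\<^sup>2 \<le> L v"
proof -
  have "sphere (0::real^'n) 1 \<noteq> {}" by simp
  then obtain e where e: "e \<in> sphere 0 1" "\<And>v. v \<in> sphere 0 1 \<Longrightarrow> L e \<le> L v"
    using continuous_attains_inf[OF compact_sphere _ continuous_L[OF continuous_on_id]] by metis
  have "0 < L e" using e(1) by (intro L_pos) auto
  moreover have "L e * (norm v)\<^sup>2 \<le> L v" for v
  proof (cases "v = 0")
    case False
    have "L e \<le> L ((1 / norm v) *\<^sub>R v)" using False by (intro e(2)) auto
    also have "\<dots> = L v / (norm v)\<^sup>2" by (simp add: L_scale power_divide)
    finally show ?thesis using False by (simp add: field_simps)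
  qed (simp add: L_zero)
  ultimately show ?thesis using that by blast
qed

lemma B_A: "B v (A *v p) = p \<bullet> v"
  by (metis A_inverse(1) A_symmetric B_def inner_commute)

lemma fenchel_equality: "p \<bullet> (A *v p) - L (A *v p) = H p"
  by (simp add: L_eq_B B_A hamiltonian_def inner_commute)

lemma fenchel_young: "p \<bullet> v \<le> H p + L v"
  using L_nonneg[of "v - A *v p"]
  by (simp add: L_diff B_A L_eq_B[of "A *v p"] hamiltonian_def inner_commute)

lemma H_subgradient: "H p + (A *v p) \<bullet> g \<le> H (p + g)"
  using fenchel_young[of "p + g" "A *v p"] fenchel_equality[of p]
  by (simp add: inner_add_left inner_commute[of g])

text \<open>A trajectory made of two uniform motions is at least as expensive as the uniform motion between its ends.\<close>
lemma action_concatenation: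
  assumes "0 < \<sigma>" "0 < \<tau>"
  shows "L (\<xi> + \<zeta>) / (\<sigma> + \<tau>) \<le> L \<xi> / \<sigma> + L \<zeta> / \<tau>"
proof -
  have "0 \<le> L (\<tau> *\<^sub>R \<xi> - \<sigma> *\<^sub>R \<zeta>) / (\<sigma> * \<tau> * (\<sigma> + \<tau>))"
    using assms L_nonneg by simp
  also have "\<dots> = L \<xi> / \<sigma> + L \<zeta> / \<tau> - L (\<xi> + \<zeta>) / (\<sigma> + \<tau>)"
    using assms by (simp add: L_diff L_add L_scale B_simps field_simps power2_eq_square)
  finally show ?thesis by simp
qed

text \<open>With \<open>\<xi>\<close> and \<open>\<tau>\<close> the displacements in space and time, this is the exact second-order expansion of the action of a
uniform motion with velocity \<open>v\<close> and duration \<open>a\<close> whose endpoint is moved: the linear part is the space-time gradient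
\<open>(- L v, B v)\<close>.\<close>
lemma action_shift:
  assumes "0 < a" "0 < a + \<tau>"
  shows "L (\<xi> + a *\<^sub>R v) / (a + \<tau>) - a * L v = B v \<xi> - \<tau> * L v + L (\<xi> - \<tau> *\<^sub>R v) / (a + \<tau>)"
proof -
  have "L (\<xi> + a *\<^sub>R v) - a * L v * (a + \<tau>) = (B v \<xi> - \<tau> * L v) * (a + \<tau>) + L (\<xi> - \<tau> *\<^sub>R v)"
    by (simp add: L_diff L_add L_scale B_simps B_sym[of \<xi>] algebra_simps power2_eq_square)
  then show ?thesis using assms by (simp add: field_simps)
qed

text \<open>The same expansion along a line of velocity \<open>w\<close>. The deviation from the action \<open>\<tau> L w\<close> is a multiple of \<open>L (w - v)\<close>,
and its sign is that of \<open>- \<tau>\<close>; this provides matching bounds forward and backward in time.\<close>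
lemma action_shift_straight:
  assumes "0 < a" "0 < a + \<tau>"
  shows "L (\<tau> *\<^sub>R w + a *\<^sub>R v) / (a + \<tau>) - a * L v = \<tau> * L w - \<tau> * (a / (a + \<tau>)) * L (w - v)"
  using assms by (simp add: L_diff L_add L_scale B_simps B_sym[of w] field_simps power2_eq_square)

end

section \<open>Viscosity subsolutions along straight lines\<close>

text \<open>The penalties in the two comparison arguments are exponentials: increasing, smooth everywhere, negligible on one
side of a threshold and huge on the other.\<close>
lemma exp_penalty_exists:
  fixes \<eta> \<delta> R :: real
  assumes "0 < \<eta>" "0 < \<delta>"
  obtains N where "0 < N" "exp (- (N * \<eta>)) < \<delta>" "R < exp (N * \<eta>)"
proof -
  define N where "N = (\<bar>R\<bar> + 1 / \<delta>) / \<eta>"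
  have N: "N * \<eta> = \<bar>R\<bar> + 1 / \<delta>" using assms by (simp add: N_def)
  have "0 < N" using assms by (simp add: N_def add_nonneg_pos)
  have *: "1 + (\<bar>R\<bar> + 1 / \<delta>) \<le> exp (N * \<eta>)" unfolding N by (rule exp_ge_add_one_self)
  then have "R < exp (N * \<eta>)" using assms by (smt (verit) divide_pos_pos)
  moreover have "1 / \<delta> < exp (N * \<eta>)" using * by linarith
  then have "exp (- (N * \<eta>)) < \<delta>"
    using assms by (simp add: exp_minus field_simps)
  ultimately show ?thesis using that \<open>0 < N\<close> by blast
qed

lemma gradient_bounded_if_touching_lipschitz_below:
  fixes u \<psi> :: "'a::euclidean_space \<Rightarrow> real"
  assumes lip: "\<Lambda>-lipschitz_on Q u" and Q: "open Q" "z \<in> Q"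
    and der: "(\<psi> has_derivative (\<lambda>h. g \<bullet> h)) (at z)"
    and min: "\<forall>\<^sub>F w in nhds z. u z - \<psi> z \<le> u w - \<psi> w"
  shows "norm g \<le> \<Lambda>"
proof -
  have lim0: "((\<lambda>\<theta>. z + \<theta> *\<^sub>R g) \<longlongrightarrow> z) (at_right (0::real))"
    by (auto intro!: tendsto_eq_intros)
  have "((\<lambda>\<theta>. \<psi> (z + \<theta> *\<^sub>R g)) has_derivative (\<lambda>\<theta>. g \<bullet> (\<theta> *\<^sub>R g))) (at 0)"
    by (rule has_derivative_compose[where g = \<psi>, of "\<lambda>\<theta>. z + \<theta> *\<^sub>R g"])
      (auto intro!: derivative_eq_intros simp: der)
  then have "((\<lambda>\<theta>. \<psi> (z + \<theta> *\<^sub>R g)) has_field_derivative (g \<bullet> g)) (at 0)"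
    by (simp add: has_field_derivative_def mult.commute[of _ "g \<bullet> g"])
  then have "((\<lambda>\<theta>. (\<psi> (z + \<theta> *\<^sub>R g) - \<psi> z) / \<theta>) \<longlongrightarrow> g \<bullet> g) (at 0)"
    by (simp add: DERIV_def)
  then have lim: "((\<lambda>\<theta>. (\<psi> (z + \<theta> *\<^sub>R g) - \<psi> z) / \<theta>) \<longlongrightarrow> g \<bullet> g) (at_right 0)"
    by (rule tendsto_within_subset) auto
  have "\<forall>\<^sub>F \<theta> in at_right 0. u z - \<psi> z \<le> u (z + \<theta> *\<^sub>R g) - \<psi> (z + \<theta> *\<^sub>R g)"
    using min lim0 by (rule eventually_compose_filterlim)
  moreover have "\<forall>\<^sub>F \<theta> in at_right (0::real). z + \<theta> *\<^sub>R g \<in> Q"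
    using lim0 Q by (rule topological_tendstoD)
  moreover have "\<forall>\<^sub>F \<theta> in at_right (0::real). 0 < \<theta>" by (rule eventually_at_right_less)
  ultimately have "\<forall>\<^sub>F \<theta> in at_right 0. (\<psi> (z + \<theta> *\<^sub>R g) - \<psi> z) / \<theta> \<le> \<Lambda> * norm g"
  proof eventually_elim
    case (elim \<theta>)
    have "u (z + \<theta> *\<^sub>R g) - u z \<le> \<Lambda> * (\<theta> * norm g)"
      using lipschitz_onD[OF lip elim(2) Q(2)] elim(3) by (simp add: dist_norm)
    then show ?case using elim by (simp add: field_simps)
  qed
  then have "g \<bullet> g \<le> \<Lambda> * norm g"
    by (intro tendsto_upperbound[OF lim]) auto
  then have "norm g * norm g \<le> \<Lambda> * norm g" by (simp add: norm_eq_sqrt_inner)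
  then show ?thesis using lipschitz_on_nonneg[OF lip]
    by (cases "norm g = 0") (auto simp: mult_le_cancel_right)
qed

context quadratic_hamiltonian begin

text \<open>On the line with velocity \<open>v\<close> a subsolution grows at most at rate \<open>L v\<close>. Otherwise \<open>u\<close> minus
\<open>L v * \<tau>\<close>, minus a strong quadratic penalty for the distance from the line, minus an increasing function of time
that becomes huge soon after \<open>t\<close>, would have an interior maximum in a tube around the segment; there the momentum
\<open>p\<close> of the test function satisfies \<open>L v - p \<bullet> v + H p < 0\<close>, against the Fenchel-Young inequality.\<close>
lemma subsolution_along_segments:
  fixes u :: "real \<times> (real^'n) \<Rightarrow> real"
  assumes sub: "viscosity_subsolution H Q u" and lip: "\<Lambda>-lipschitz_on Q u" and Q: "open Q"
    and st: "s < t" and seg: "closed_segment (s, y) (t, x) \<subseteq> Q"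
  shows "u (t, x) \<le> u (s, y) + L (x - y) / (t - s)"
proof (rule ccontr)
  assume contra: "\<not> ?thesis"
  define v where "v = (x - y) /\<^sub>R (t - s)"
  define line where "line \<tau> = y + (\<tau> - s) *\<^sub>R v" for \<tau>
  define \<delta> where "\<delta> = (u (t, x) - u (s, y) - (t - s) * L v) / 3"
  have ends: "line s = y" "line t = x" using st by (auto simp: line_def v_def)
  have "(t - s) * L v = L (x - y) / (t - s)"
    using st unfolding v_def L_scale
    by (simp add: power2_eq_square divide_inverse)
  then have "0 < \<delta>" using contra by (simp add: \<delta>_def)
  have gap: "u (t, x) = u (s, y) + (t - s) * L v + 3 * \<delta>" unfolding \<delta>_def by argo
  have \<Lambda>: "0 \<le> \<Lambda>" using lip by (rule lipschitz_on_nonneg)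
  have on_segment: "(\<tau>, line \<tau>) \<in> closed_segment (s, y) (t, x)" if "\<tau> \<in> {s..t}" for \<tau>
  proof -
    define \<mu> where "\<mu> = (\<tau> - s) / (t - s)"
    have \<mu>: "0 \<le> \<mu>" "\<mu> \<le> 1" "\<mu> * (t - s) = \<tau> - s" using that st by (auto simp: \<mu>_def)
    have "x - y = (t - s) *\<^sub>R v" using st by (simp add: v_def)
    then have "\<mu> *\<^sub>R (x - y) = (\<tau> - s) *\<^sub>R v" using \<mu>(3) by simp
    then have "(\<tau>, line \<tau>) = (1 - \<mu>) *\<^sub>R (s, y) + \<mu> *\<^sub>R (t, x)"
      using \<mu>(3) by (simp add: line_def algebra_simps)
    then show ?thesis
      unfolding closed_segment_def using \<mu>(1,2) by blast
  qed
  obtain \<rho> where \<rho>: "0 < \<rho>" "(\<Union>p\<in>closed_segment (s, y) (t, x). ball p \<rho>) \<subseteq> Q"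
    using compact_subset_open_imp_ball_epsilon_subset[OF compact_segment Q seg] by blast
  define \<eta> where "\<eta> = \<rho> / (4 * (1 + norm v))"
  have \<eta>: "0 < \<eta>" "2 * \<eta> * (1 + norm v) = \<rho> / 2"
    using \<rho> by (auto simp: \<eta>_def add_pos_nonneg divide_simps) (smt (verit) norm_ge_zero)+
  define \<rho>' where "\<rho>' = \<rho> / 4"
  have \<rho>': "0 < \<rho>'" using \<rho> by (simp add: \<rho>'_def)
  define D where "D = {s..t + 2 * \<eta>} \<times> cball (0::real^'n) \<rho>'"
  have move: "dist (\<tau>, line \<tau> + e) (\<sigma>, line \<sigma>) \<le> \<bar>\<tau> - \<sigma>\<bar> * (1 + norm v) + norm e" for \<tau> \<sigma> e
  proof -
    have "dist (\<tau>, line \<tau> + e) (\<sigma>, line \<sigma>) \<le> \<bar>\<tau> - \<sigma>\<bar> + norm (line \<tau> + e - line \<sigma>)"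
      using norm_Pair_le[of "\<tau> - \<sigma>" "line \<tau> + e - line \<sigma>"] by (simp add: dist_norm)
    also have "line \<tau> + e - line \<sigma> = (\<tau> - \<sigma>) *\<^sub>R v + e" by (simp add: line_def algebra_simps)
    also have "norm \<dots> \<le> \<bar>\<tau> - \<sigma>\<bar> * norm v + norm e"
      using norm_triangle_ineq[of "(\<tau> - \<sigma>) *\<^sub>R v" e] by simp
    finally show ?thesis by (simp add: algebra_simps)
  qed
  have tube: "(\<tau>, line \<tau> + e) \<in> Q" if "(\<tau>, e) \<in> D" for \<tau> e
  proof -
    define \<sigma> where "\<sigma> = min \<tau> t"
    have \<sigma>: "\<sigma> \<in> {s..t}" "\<bar>\<tau> - \<sigma>\<bar> \<le> 2 * \<eta>" using that st \<eta> by (auto simp: D_def \<sigma>_def)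
    have "dist (\<tau>, line \<tau> + e) (\<sigma>, line \<sigma>) \<le> 2 * \<eta> * (1 + norm v) + norm e"
      using move[of \<tau> e \<sigma>] mult_right_mono[OF \<sigma>(2), of "1 + norm v"] by simp
    also have "\<dots> < \<rho>" using that \<rho> unfolding \<eta>(2) by (auto simp: D_def \<rho>'_def)
    finally show ?thesis using on_segment[OF \<sigma>(1)]
      by (intro subsetD[OF \<rho>(2)] UN_I) (auto simp: dist_commute)
  qed
  have lipu: "u (\<tau>, line \<tau> + e) \<le> u (\<sigma>, line \<sigma>) + \<Lambda> * (\<bar>\<tau> - \<sigma>\<bar> * (1 + norm v) + norm e)"
    if "(\<tau>, e) \<in> D" "\<sigma> \<in> {s..t}" for \<tau> e \<sigma>
  proof -
    have "(\<sigma>, line \<sigma>) \<in> Q" using on_segment[OF that(2)] seg by auto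
    then have "u (\<tau>, line \<tau> + e) - u (\<sigma>, line \<sigma>) \<le> \<Lambda> * dist (\<tau>, line \<tau> + e) (\<sigma>, line \<sigma>)"
      using lipschitz_onD[OF lip tube[OF that(1)], of "(\<sigma>, line \<sigma>)"] unfolding dist_real_def by linarith
    also have "\<dots> \<le> \<Lambda> * (\<bar>\<tau> - \<sigma>\<bar> * (1 + norm v) + norm e)"
      by (intro mult_left_mono move \<Lambda>)
    finally show ?thesis by simp
  qed
  obtain N where N: "0 < N" "exp (- (N * \<eta>)) < \<delta>" "\<Lambda> * (2 * \<eta> * (1 + norm v)) + 2 * \<delta> < exp (N * \<eta>)"
    using exp_penalty_exists[OF \<eta>(1) \<open>0 < \<delta>\<close>] by metis
  define R where "R = \<Lambda> * ((t - s + 2 * \<eta>) * (1 + norm v) + \<rho>') + \<delta> + (t - s) * L v"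
  define K where "K = 1 + \<Lambda>\<^sup>2 / \<delta> + 2 * R / \<rho>'\<^sup>2"
  have "0 \<le> R" unfolding R_def using \<Lambda> st \<eta> \<rho>' \<open>0 < \<delta>\<close> L_nonneg by auto
  then have K0: "0 < K" and K1: "\<Lambda>\<^sup>2 / \<delta> < K" and K2: "2 * R / \<rho>'\<^sup>2 < K"
    using \<open>0 < \<delta>\<close> \<rho>' by (auto simp: K_def add_pos_nonneg add_nonneg_pos)
  have quad: "\<Lambda> * r - K / 2 * r\<^sup>2 < \<delta>" for r
  proof -
    have "\<Lambda> * r - K / 2 * r\<^sup>2 = \<Lambda>\<^sup>2 / (2 * K) - K / 2 * (r - \<Lambda> / K)\<^sup>2"
      using K0 by (simp add: power2_eq_square field_simps)
    also have "\<dots> \<le> \<Lambda>\<^sup>2 / (2 * K)" using K0 by simp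
    also have "\<dots> < \<delta>"
    proof -
      have "\<Lambda>\<^sup>2 < K * \<delta>" using K1 \<open>0 < \<delta>\<close> by (simp add: pos_divide_less_eq)
      moreover have "0 < K * \<delta>" using K0 \<open>0 < \<delta>\<close> by simp
      ultimately have "\<Lambda>\<^sup>2 < 2 * (K * \<delta>)" by linarith
      then show ?thesis using K0 by (simp add: pos_divide_less_eq ac_simps)
    qed
    finally show ?thesis .
  qed
  \<comment> \<open>The tube is parametrized by time and by the displacement from the line.\<close>
  define J where "J p = u (fst p, line (fst p) + snd p) - L v * fst p - K / 2 * (snd p \<bullet> snd p)
      - exp (N * (fst p - t - \<eta>))" for p
  have "continuous_on D J"
  proof -
    have "continuous_on D (\<lambda>p. u (fst p, line (fst p) + snd p))"
      by (rule continuous_on_compose2[OF lipschitz_on_continuous_on[OF lip]])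
        (auto simp: line_def intro!: continuous_intros tube[unfolded line_def])
    then show ?thesis unfolding J_def by (intro continuous_intros) auto
  qed
  moreover have "compact D" by (auto simp: D_def intro: compact_Times)
  moreover have "(t, 0) \<in> D" using st \<eta> \<rho>' by (auto simp: D_def)
  ultimately obtain \<tau> e where max: "(\<tau>, e) \<in> D" "\<And>p. p \<in> D \<Longrightarrow> J p \<le> J (\<tau>, e)"
    using continuous_attains_sup[of D J] by (metis empty_iff surj_pair)
  have "J (t, 0) = u (t, x) - L v * t - exp (- (N * \<eta>))"
    by (simp add: J_def ends algebra_simps)
  then have big: "u (t, x) - L v * t - \<delta> < J (\<tau>, e)"
    using max(2)[OF \<open>(t, 0) \<in> D\<close>] N(2) by linarith
  define E where "E = exp (N * (\<tau> - t - \<eta>))"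
  have Je: "J (\<tau>, e) = u (\<tau>, line \<tau> + e) - L v * \<tau> - K / 2 * (norm e)\<^sup>2 - E"
    by (simp add: J_def E_def power2_norm_eq_inner)
  have expos: "0 < E" by (simp add: E_def)
  have "\<tau> \<noteq> s"
  proof
    assume "\<tau> = s"
    then have "u (\<tau>, line \<tau> + e) \<le> u (s, y) + \<Lambda> * norm e"
      using lipu[OF max(1), of s] st ends by simp
    then show False using big Je quad[of "norm e"] expos gap \<open>0 < \<delta>\<close>
      unfolding \<open>\<tau> = s\<close> by (simp add: algebra_simps)
  qed
  moreover have "\<tau> \<noteq> t + 2 * \<eta>"
  proof
    assume \<tau>: "\<tau> = t + 2 * \<eta>"
    then have "u (\<tau>, line \<tau> + e) \<le> u (t, x) + \<Lambda> * (2 * \<eta> * (1 + norm v) + norm e)"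
      using lipu[OF max(1), of t] st ends \<eta>(1) by simp
    moreover have "E = exp (N * \<eta>)" using \<tau> by (simp add: E_def)
    moreover have "L v * t \<le> L v * \<tau>" using \<tau> \<eta>(1) L_nonneg[of v] by (intro mult_left_mono) auto
    ultimately show False using big Je quad[of "norm e"] N(3) by (simp add: algebra_simps)
  qed
  moreover have "norm e \<noteq> \<rho>'"
  proof
    assume e: "norm e = \<rho>'"
    have "u (\<tau>, line \<tau> + e) \<le> u (t, x) + \<Lambda> * (\<bar>\<tau> - t\<bar> * (1 + norm v) + \<rho>')"
      using lipu[OF max(1), of t] st ends e by simp
    also have "\<dots> \<le> u (t, x) + \<Lambda> * ((t - s + 2 * \<eta>) * (1 + norm v) + \<rho>')"
      using max(1) \<eta>(1) st by (intro add_left_mono mult_left_mono add_right_mono mult_right_mono \<Lambda>) (auto simp: D_def)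
    finally have "u (\<tau>, line \<tau> + e) \<le> u (t, x) + R - \<delta> - (t - s) * L v" by (simp add: R_def)
    moreover have "L v * s \<le> L v * \<tau>" using max(1) L_nonneg[of v] by (intro mult_left_mono) (auto simp: D_def)
    moreover have "R < K / 2 * \<rho>'\<^sup>2" using K2 \<rho>' by (simp add: field_simps)
    ultimately show False using big Je expos unfolding e by (simp add: algebra_simps)
  qed
  ultimately have inner: "s < \<tau>" "\<tau> < t + 2 * \<eta>" "norm e < \<rho>'"
    using max(1) by (auto simp: D_def)
  define \<psi> where "\<psi> w = L v * fst w + K / 2 * ((snd w - line (fst w)) \<bullet> (snd w - line (fst w)))
      + exp (N * (fst w - t - \<eta>))" for w
  define G where "G w = (L v - K * ((snd w - line (fst w)) \<bullet> v) + N * exp (N * (fst w - t - \<eta>)),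
      K *\<^sub>R (snd w - line (fst w)))" for w
  have "C1_with_gradient Q \<psi> G"
    unfolding C1_with_gradient_def
  proof (intro conjI ballI)
    fix w
    show "(\<psi> has_derivative (\<lambda>h. G w \<bullet> h)) (at w)"
      unfolding \<psi>_def G_def line_def
      by (rule derivative_eq_intros refl | simp)+
        (auto simp: fun_eq_iff algebra_simps add_divide_distrib diff_divide_distrib inner_commute inner_diff_left inner_diff_right inner_add_left inner_add_right)
    show "continuous_on Q G"
      unfolding G_def line_def by (intro continuous_intros)
  qed
  moreover have "\<forall>\<^sub>F w in nhds (\<tau>, line \<tau> + e). u w - \<psi> w \<le> u (\<tau>, line \<tau> + e) - \<psi> (\<tau>, line \<tau> + e)"
  proof -
    define W where "W = {w::real \<times> (real^'n). s < fst w} \<inter> {w. fst w < t + 2 * \<eta>} \<inter> {w. norm (snd w - line (fst w)) < \<rho>'}"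
    have "open W" unfolding W_def line_def
      by (intro open_Int open_Collect_less continuous_intros)
    moreover have "(\<tau>, line \<tau> + e) \<in> W" using inner by (simp add: W_def)
    moreover have "u w - \<psi> w \<le> u (\<tau>, line \<tau> + e) - \<psi> (\<tau>, line \<tau> + e)" if "w \<in> W" for w
      using max(2)[of "(fst w, snd w - line (fst w))"] that
      by (auto simp: J_def \<psi>_def W_def D_def)
    ultimately show ?thesis unfolding eventually_nhds by blast
  qed
  moreover have "(\<tau>, line \<tau> + e) \<in> Q" by (rule tube[OF max(1)])
  ultimately have "fst (G (\<tau>, line \<tau> + e)) + H (snd (G (\<tau>, line \<tau> + e))) \<le> 0"
    using sub unfolding viscosity_subsolution_def by blast
  then have "L v - (K *\<^sub>R e) \<bullet> v + N * exp (N * (\<tau> - t - \<eta>)) + H (K *\<^sub>R e) \<le> 0"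
    by (simp add: G_def)
  moreover have "0 < N * exp (N * (\<tau> - t - \<eta>))" using N by simp
  ultimately show False using fenchel_young[of "K *\<^sub>R e" v] by linarith
qed

end

section \<open>Viscosity supersolutions and the backward Hopf-Lax bound\<close>

lemma nonneg_if_nonneg_perturbed:
  fixes X Y \<theta>0 :: real
  assumes "0 < \<theta>0" "\<And>\<theta>. 0 < \<theta> \<Longrightarrow> \<theta> < \<theta>0 \<Longrightarrow> 0 \<le> X + \<theta> * Y"
  shows "0 \<le> X"
proof -
  have "((\<lambda>\<theta>. X + \<theta> * Y) \<longlongrightarrow> X) (at_right 0)" by (auto intro!: tendsto_eq_intros)
  moreover have "\<forall>\<^sub>F \<theta> in at_right 0. 0 \<le> X + \<theta> * Y"
    using assms by (auto simp: eventually_at_right_field intro!: exI[of _ \<theta>0])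
  ultimately show ?thesis by (rule tendsto_lowerbound) auto
qed

context quadratic_hamiltonian begin

text \<open>The Hopf-Lax function \<open>V\<close>, started from \<open>u\<close> at time \<open>s\<close>, stays below the supersolution \<open>u\<close>. The duration of the
motion is increased by \<open>\<kappa>\<close>: this removes the singularity of the action at time \<open>s\<close>, and as the choice \<open>z = \<xi>\<close> is
allowed, \<open>V \<le> u\<close> still holds there.

As \<open>V\<close> is not smooth, the variables are doubled: the function \<open>u w - V w' + K/2 \<bar>w - w'\<bar>\<^sup>2 + G w\<close> is minimized. The
property of \<open>V\<close> that matters is that it grows at most at rate \<open>L v\<close> along lines, which makes it a subsolution at the
minimum. The penalty \<open>G\<close> is an increasing function of \<open>\<bar>\<xi> - x\<bar>\<^sup>2 + C (\<tau> - t)\<close>. It keeps the minimum away from the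
lateral and the final boundary. Since \<open>u\<close> is \<open>\<Lambda>\<close>-Lipschitz, signals travel with bounded speed, and \<open>C\<close> is chosen such
that the level sets of \<open>G\<close> move faster: then the time derivative of \<open>G\<close> exceeds the change of the Hamiltonian caused
by its spatial gradient, and the two viscosity inequalities contradict each other.\<close>
lemma supersolution_regularized_bound:
  fixes u :: "real \<times> (real^'n) \<Rightarrow> real"
  assumes super: "viscosity_supersolution H Q u" and lip: "\<Lambda>-lipschitz_on Q u" and Q: "open Q"
    and st: "s < t" and r: "0 < r" and \<kappa>: "0 < \<kappa>"
    and normA: "\<And>p. norm (A *v p) \<le> a * norm p" and a: "0 \<le> a"
    and C: "2 * r * a * \<Lambda> < C" and cone: "C * (t - s) \<le> r\<^sup>2 / 2"
    and cyl: "{s..t + r\<^sup>2 / (2 * C)} \<times> cball x r \<subseteq> Q"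
  shows "\<exists>z\<in>cball x r. u (s, z) + L (x - z) / (t - s + \<kappa>) \<le> u (t, x)"
proof (rule ccontr)
  assume contra: "\<not> ?thesis"
  have \<Lambda>: "0 \<le> \<Lambda>" using lip by (rule lipschitz_on_nonneg)
  have "0 \<le> 2 * r * a * \<Lambda>" using r a \<Lambda> by simp
  then have C0: "0 < C" using C by linarith
  \<comment> \<open>At time \<open>T\<close>, and for \<open>\<bar>\<xi> - x\<bar> = r\<close> at any time from \<open>s\<close> on, the exponent of \<open>G\<close> is at least \<open>N * b\<close>; at \<open>(t, x)\<close> it
    is \<open>- N * b\<close>.\<close>
  define T where "T = t + r\<^sup>2 / (2 * C)"
  define b where "b = r\<^sup>2 / 4"
  have T: "t < T" "C * (T - t) = 2 * b" using C0 r by (auto simp: T_def b_def)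
  have b: "0 < b" using r by (simp add: b_def)
  define D where "D = {s..T} \<times> cball x r"
  define D' where "D' = {s..T + 1} \<times> cball x (r + 1)"
  have DQ: "D \<subseteq> Q" using cyl by (simp add: D_def T_def)
  have DD': "D \<subseteq> D'" using r by (auto simp: D_def D'_def)
  have compact: "compact D" "compact D'" by (auto simp: D_def D'_def intro: compact_Times)
  have contu: "continuous_on D u"
    using lipschitz_on_continuous_on[OF lip] DQ by (rule continuous_on_subset)
  define \<Phi> where "\<Phi> z w = u (s, z) + L (snd w - z) / (fst w - s + \<kappa>)" for z w
  have bottom: "(s, z) \<in> D" if "z \<in> cball x r" for z
    using that st T by (auto simp: D_def)
  have cont\<Phi>: "continuous_on (cball x r \<times> {w. s \<le> fst w}) (\<lambda>p. \<Phi> (fst p) (snd p))"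
  proof -
    have "continuous_on (cball x r \<times> {w. s \<le> fst w}) (\<lambda>p. u (s, fst p))"
      by (rule continuous_on_compose2[OF contu]) (auto intro!: continuous_intros bottom)
    then show ?thesis unfolding \<Phi>_def using \<kappa> by (intro continuous_intros) auto
  qed
  have "\<exists>z\<in>cball x r. \<forall>z'\<in>cball x r. \<Phi> z w \<le> \<Phi> z' w" if "s \<le> fst w" for w
  proof (rule continuous_attains_inf)
    show "continuous_on (cball x r) (\<lambda>z. \<Phi> z w)"
    proof -
      have "continuous_on (cball x r) (\<lambda>z. \<Phi> (fst (z, w)) (snd (z, w)))"
        by (rule continuous_on_compose2[OF cont\<Phi>, where f = "\<lambda>z. (z, w)"])
          (use that in \<open>auto intro!: continuous_intros\<close>)
      then show ?thesis by simp
    qed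
  qed (use r in auto)
  then obtain m where m: "\<And>w. s \<le> fst w \<Longrightarrow> m w \<in> cball x r"
      "\<And>w z. s \<le> fst w \<Longrightarrow> z \<in> cball x r \<Longrightarrow> \<Phi> (m w) w \<le> \<Phi> z w"
    by metis
  define V where "V w = \<Phi> (m w) w" for w
  have sD': "s \<le> fst w" if "w \<in> D'" for w using that by (auto simp: D'_def)
  have unifV: "\<exists>d>0. \<forall>w\<in>D'. \<forall>w'\<in>D'. dist w w' < d \<longrightarrow> V w' \<le> V w + e" if "0 < e" for e
  proof -
    have "uniformly_continuous_on (cball x r \<times> D') (\<lambda>p. \<Phi> (fst p) (snd p))"
      by (intro compact_uniformly_continuous continuous_on_subset[OF cont\<Phi>] compact_Times compact)
        (auto simp: D'_def)
    then obtain d where d: "0 < d" "\<And>p p'. p \<in> cball x r \<times> D' \<Longrightarrow> p' \<in> cball x r \<times> D' \<Longrightarrow> dist p' p < d \<Longrightarrow>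
        dist (\<Phi> (fst p') (snd p')) (\<Phi> (fst p) (snd p)) < e"
      using \<open>0 < e\<close> unfolding uniformly_continuous_on_def by metis
    have "V w' \<le> V w + e" if w: "w \<in> D'" "w' \<in> D'" "dist w w' < d" for w w'
    proof -
      have "dist (\<Phi> (m w) w') (\<Phi> (m w) w) < e"
        using d(2)[of "(m w, w)" "(m w, w')"] w m(1)[OF sD'] by (auto simp: dist_Pair_Pair dist_commute)
      then have "\<Phi> (m w) w' < \<Phi> (m w) w + e" by (auto simp: dist_real_def)
      moreover have "V w' \<le> \<Phi> (m w) w'" unfolding V_def using w sD' m by blast
      ultimately show ?thesis unfolding V_def by linarith
    qed
    then show ?thesis using d(1) by blast
  qed
  have contV: "continuous_on D' V"
    unfolding continuous_on_iff
  proof (intro ballI allI impI)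
    fix w and e :: real assume "w \<in> D'" "0 < e"
    obtain d where "0 < d" "\<forall>w\<in>D'. \<forall>w'\<in>D'. dist w w' < d \<longrightarrow> V w' \<le> V w + e / 2"
      using unifV[of "e / 2"] \<open>0 < e\<close> by auto
    then show "\<exists>d>0. \<forall>x'\<in>D'. dist x' w < d \<longrightarrow> dist (V x') (V w) < e"
      using \<open>w \<in> D'\<close> \<open>0 < e\<close>
      by (intro exI[of _ d]) (force simp: dist_real_def dist_commute abs_less_iff)
  qed
  have V_le_u: "V w \<le> u w + \<Lambda> * (fst w - s)" if "w \<in> D" for w
  proof -
    have w: "s \<le> fst w" "snd w \<in> cball x r" using that by (auto simp: D_def)
    have "V w \<le> \<Phi> (snd w) w" unfolding V_def using m(2) w by blast
    also have "\<dots> = u (s, snd w)" by (simp add: \<Phi>_def L_zero)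
    finally have "V w \<le> u (s, snd w)" .
    moreover have "dist (u (s, snd w)) (u w) \<le> \<Lambda> * dist (s, snd w) w"
      using bottom[OF w(2)] that DQ by (intro lipschitz_onD[OF lip]) auto
    moreover have eq: "dist (s, snd w) w = fst w - s" using w by (cases w) (simp add: dist_Pair_Pair dist_real_def)
    ultimately show ?thesis unfolding dist_real_def eq by linarith
  qed
  have V_segment: "V (\<tau>, \<xi>) \<le> V (\<tau> - \<theta>, \<xi> - \<theta> *\<^sub>R v) + \<theta> * L v" if "0 < \<theta>" "s \<le> \<tau> - \<theta>" for \<tau> \<xi> \<theta> v
  proof -
    define z where "z = m (\<tau> - \<theta>, \<xi> - \<theta> *\<^sub>R v)"
    have "V (\<tau>, \<xi>) \<le> \<Phi> z (\<tau>, \<xi>)"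
      unfolding V_def z_def using that by (intro m) auto
    also have "\<dots> \<le> \<Phi> z (\<tau> - \<theta>, \<xi> - \<theta> *\<^sub>R v) + \<theta> * L v"
      using action_concatenation[of "\<tau> - \<theta> - s + \<kappa>" \<theta> "\<xi> - \<theta> *\<^sub>R v - z" "\<theta> *\<^sub>R v"] that \<kappa>
      by (simp add: \<Phi>_def L_scale power2_eq_square algebra_simps)
    finally show ?thesis unfolding V_def z_def .
  qed
  define \<delta> where "\<delta> = (V (t, x) - u (t, x)) / 2"
  have "0 < \<delta>"
    using contra m(1)[of "(t, x)"] st by (auto simp: \<delta>_def V_def \<Phi>_def not_le)
  obtain N where N: "0 < N" "exp (- (N * b)) < \<delta>" "\<Lambda> * (T - s) < exp (N * b)"
    using exp_penalty_exists[OF b \<open>0 < \<delta>\<close>] by metis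
  define G where "G w = exp (N * ((snd w - x) \<bullet> (snd w - x) + C * (fst w - t) - b))" for w :: "real \<times> (real^'n)"
  obtain d where d: "0 < d" "\<And>w w'. w \<in> D' \<Longrightarrow> w' \<in> D' \<Longrightarrow> dist w w' < d \<Longrightarrow> V w' \<le> V w + \<delta> / 2"
    using unifV[of "\<delta> / 2"] \<open>0 < \<delta>\<close> by auto
  define \<epsilon> where "\<epsilon> = min d (min 1 (\<delta> / (2 * (\<Lambda> + 1))))"
  have \<epsilon>: "0 < \<epsilon>" "\<epsilon> \<le> d" "\<epsilon> \<le> 1" "\<epsilon> \<le> \<delta> / (2 * (\<Lambda> + 1))"
    using d(1) \<open>0 < \<delta>\<close> \<Lambda> by (auto simp: \<epsilon>_def)
  have "\<Lambda> * \<epsilon> \<le> (\<Lambda> + 1) * (\<delta> / (2 * (\<Lambda> + 1)))" using \<epsilon> \<Lambda> by (intro mult_mono) auto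
  moreover have "\<Lambda> + 1 \<noteq> 0" using \<Lambda> by linarith
  then have "(\<Lambda> + 1) * (\<delta> / (2 * (\<Lambda> + 1))) = \<delta> / 2" by (simp add: divide_simps)
  ultimately have \<Lambda>\<epsilon>: "\<Lambda> * \<epsilon> \<le> \<delta> / 2" by linarith
  obtain M1 where M1: "\<And>w. w \<in> D \<Longrightarrow> \<bar>u w\<bar> \<le> M1"
    using compact_imp_bounded[OF compact_continuous_image[OF contu compact(1)]]
    unfolding bounded_iff by (auto simp: real_norm_def)
  obtain M2 where M2: "\<And>w. w \<in> D' \<Longrightarrow> \<bar>V w\<bar> \<le> M2"
    using compact_imp_bounded[OF compact_continuous_image[OF contV compact(2)]]
    unfolding bounded_iff by (auto simp: real_norm_def)
  have txD: "(t, x) \<in> D" using st T r by (auto simp: D_def)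
  have M: "0 \<le> M1 + M2" using M1[OF txD] M2[of "(t, x)"] txD DD' by fastforce
  define K where "K = 1 + 2 * (M1 + M2) / \<epsilon>\<^sup>2"
  have K: "0 < K" using M \<epsilon> by (simp add: K_def add_pos_nonneg)
  define J where "J p = u (fst p) - V (snd p) + K / 2 * ((fst p - snd p) \<bullet> (fst p - snd p)) + G (fst p)" for p
  have "continuous_on (D \<times> D') J"
  proof -
    have "continuous_on (D \<times> D') (\<lambda>p. u (fst p))" "continuous_on (D \<times> D') (\<lambda>p. V (snd p))"
      by (auto intro!: continuous_on_compose2[OF contu] continuous_on_compose2[OF contV] continuous_intros)
    then show ?thesis unfolding J_def G_def by (intro continuous_intros) auto
  qed
  moreover have "compact (D \<times> D')" by (intro compact_Times compact)
  moreover have "D \<times> D' \<noteq> {}" using txD DD' by auto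
  ultimately obtain w w' where ww': "w \<in> D" "w' \<in> D'" and min: "\<And>p. p \<in> D \<times> D' \<Longrightarrow> J (w, w') \<le> J p"
    using continuous_attains_inf[of "D \<times> D'" J] by fastforce
  have "J ((t, x), (t, x)) = - 2 * \<delta> + exp (- (N * b))" by (simp add: J_def G_def \<delta>_def)
  then have neg: "J (w, w') < - \<delta>" using min[of "((t, x), (t, x))"] txD DD' N(2) by auto
  have Jw: "J (w, w') = u w - V w' + K / 2 * (dist w w')\<^sup>2 + G w"
    by (simp add: J_def dist_norm power2_norm_eq_inner)
  have G0: "0 < G w" by (simp add: G_def)
  have "K / 2 * (dist w w')\<^sup>2 < M1 + M2"
    using neg Jw G0 M1[OF ww'(1)] M2[OF ww'(2)] \<open>0 < \<delta>\<close> by linarith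
  also have "\<dots> < K / 2 * \<epsilon>\<^sup>2" using \<epsilon>(1) by (simp add: K_def field_simps)
  finally have "(dist w w')\<^sup>2 < \<epsilon>\<^sup>2" using K by simp
  then have close: "dist w w' < \<epsilon>" using \<epsilon>(1) by (simp add: power2_less_imp_less)
  have wD': "w \<in> D'" using ww' DD' by auto
  have "u w - V w + G w < - \<delta> / 2"
  proof -
    have "0 \<le> K / 2 * (dist w w')\<^sup>2" using K by simp
    then show ?thesis using neg Jw d(2)[OF wD' ww'(2)] close \<epsilon>(2) by linarith
  qed
  \<comment> \<open>From here on the minimum point is shown to be interior: neither initial, nor final, nor lateral.\<close>
  then have Gless: "G w < \<Lambda> * (fst w - s) - \<delta> / 2" using V_le_u[OF ww'(1)] by linarith
  have ws: "s + \<epsilon> < fst w"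
  proof (rule ccontr)
    assume "\<not> s + \<epsilon> < fst w"
    then have "\<Lambda> * (fst w - s) \<le> \<Lambda> * \<epsilon>" using \<Lambda> by (intro mult_left_mono) auto
    then show False using Gless G0 \<Lambda>\<epsilon> by linarith
  qed
  have "\<Lambda> * (fst w - s) \<le> \<Lambda> * (T - s)" using ww'(1) \<Lambda> by (intro mult_left_mono) (auto simp: D_def)
  then have "G w < exp (N * b)" using Gless N(3) \<open>0 < \<delta>\<close> by linarith
  then have Gexp: "(snd w - x) \<bullet> (snd w - x) + C * (fst w - t) < 2 * b"
    using N(1) by (simp add: G_def)
  have wT: "fst w < T"
  proof -
    have "0 \<le> (snd w - x) \<bullet> (snd w - x)" by simp
    then have "C * (fst w - t) < C * (T - t)" unfolding T(2) using Gexp by linarith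
    then show ?thesis using C0 by simp
  qed
  have wr: "norm (snd w - x) < r"
  proof -
    have "C * (s - t) \<le> C * (fst w - t)" using ws \<epsilon> C0 by (intro mult_left_mono) auto
    moreover have "C * (s - t) = - (C * (t - s))" by (simp add: algebra_simps)
    ultimately have "(norm (snd w - x))\<^sup>2 < r\<^sup>2"
      using Gexp cone unfolding power2_norm_eq_inner b_def by linarith
    then show ?thesis using r by (simp add: power2_less_imp_less)
  qed
  obtain \<tau> \<xi> \<tau>' \<xi>' where w: "w = (\<tau>, \<xi>)" and w': "w' = (\<tau>', \<xi>')" by fastforce
  define q where "q = K * (\<tau>' - \<tau>)"
  define p where "p = K *\<^sub>R (\<xi>' - \<xi>)"
  have "\<bar>\<tau> - \<tau>'\<bar> < \<epsilon>" "norm (\<xi> - \<xi>') < \<epsilon>"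
    using close dist_fst_le[of w w'] dist_snd_le[of w w'] by (auto simp: w w' dist_norm dist_real_def)
  then have \<tau>': "s < \<tau>'" and \<xi>': "norm (\<xi>' - x) < r + 1"
    using ws wr \<epsilon>(3) norm_triangle_ineq[of "\<xi>' - \<xi>" "\<xi> - x"] by (auto simp: w norm_minus_commute)
  have Vsub: "q + H p \<le> 0"
  proof -
    define v where "v = A *v p"
    define \<theta>0 where "\<theta>0 = min (\<tau>' - s) ((r + 1 - norm (\<xi>' - x)) / (1 + norm v))"
    have \<theta>0: "0 < \<theta>0" using \<tau>' \<xi>' by (auto simp: \<theta>0_def intro!: divide_pos_pos add_pos_nonneg)
    \<comment> \<open>The point \<open>w'\<close> is compared with the earlier point \<open>w' - \<theta> (1, v)\<close> on the line through it.\<close>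
    have "0 \<le> (L v - q - p \<bullet> v) + \<theta> * (K / 2 * (1 + v \<bullet> v))" if \<theta>: "0 < \<theta>" "\<theta> < \<theta>0" for \<theta>
    proof -
      define w1 where "w1 = (\<tau>' - \<theta>, \<xi>' - \<theta> *\<^sub>R v)"
      have "\<theta> * (1 + norm v) < r + 1 - norm (\<xi>' - x)"
        using \<theta> by (simp add: \<theta>0_def pos_less_divide_eq add_pos_nonneg)
      then have "norm (\<xi>' - \<theta> *\<^sub>R v - x) \<le> r + 1"
        using norm_triangle_ineq4[of "\<xi>' - x" "\<theta> *\<^sub>R v"] \<theta> by (simp add: algebra_simps)
      then have "w1 \<in> D'" using \<theta> ww'(2) by (auto simp: w1_def D'_def \<theta>0_def w' dist_norm norm_minus_commute)
      then have "J (w, w') \<le> J (w, w1)" using min ww' by auto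
      moreover have "V w' \<le> V w1 + \<theta> * L v"
        unfolding w' w1_def using \<theta> by (intro V_segment) (auto simp: \<theta>0_def)
      ultimately have "0 \<le> \<theta> * L v + K / 2 * ((w - w1) \<bullet> (w - w1) - (w - w') \<bullet> (w - w'))"
        by (simp add: J_def algebra_simps)
      also have "w - w1 = (w - w') + \<theta> *\<^sub>R (1, v)" by (simp add: w w' w1_def)
      also have "((w - w') + \<theta> *\<^sub>R (1, v)) \<bullet> ((w - w') + \<theta> *\<^sub>R (1, v)) - (w - w') \<bullet> (w - w') =
          \<theta> * (2 * ((\<tau> - \<tau>') + (\<xi> - \<xi>') \<bullet> v) + \<theta> * (1 + v \<bullet> v))"
        by (simp add: w w' inner_add_left inner_add_right inner_diff_left inner_diff_right inner_commute algebra_simps power2_eq_square)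
      also have "\<theta> * L v + K / 2 * \<dots> = \<theta> * ((L v - q - p \<bullet> v) + \<theta> * (K / 2 * (1 + v \<bullet> v)))"
        by (simp add: q_def p_def inner_diff_left algebra_simps)
      finally show ?thesis using \<theta>(1) by (simp add: zero_le_mult_iff)
    qed
    then have "0 \<le> L v - q - p \<bullet> v" using nonneg_if_nonneg_perturbed[OF \<theta>0] by blast
    then show ?thesis using fenchel_equality[of p] by (simp add: v_def)
  qed
  define \<psi> where "\<psi> z = - (K / 2 * ((z - w') \<bullet> (z - w'))) - G z" for z
  define g where "g z = (- K * (fst z - \<tau>') - N * G z * C, - (K *\<^sub>R (snd z - \<xi>')) - (2 * N * G z) *\<^sub>R (snd z - x))" for z
  have C1: "C1_with_gradient Q \<psi> g"
    unfolding C1_with_gradient_def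
  proof (intro conjI ballI)
    fix z
    show "(\<psi> has_derivative (\<lambda>h. g z \<bullet> h)) (at z)"
      unfolding \<psi>_def g_def w' G_def
      by (rule derivative_eq_intros refl | simp)+
        (auto simp: fun_eq_iff algebra_simps add_divide_distrib diff_divide_distrib inner_prod_def inner_commute
          inner_diff_left inner_diff_right inner_add_left inner_add_right)
    show "continuous_on Q g"
      unfolding g_def G_def by (intro continuous_intros)
  qed
  have wQ: "w \<in> Q" using ww' DQ by auto
  have touch: "\<forall>\<^sub>F z in nhds w. u w - \<psi> w \<le> u z - \<psi> z"
  proof -
    define W where "W = {s<..<T} \<times> ball x r"
    have "open W" by (auto simp: W_def intro: open_Times)
    moreover have "w \<in> W" using ws wT wr \<epsilon> by (auto simp: W_def w dist_norm norm_minus_commute)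
    moreover have "u w - \<psi> w \<le> u z - \<psi> z" if "z \<in> W" for z
    proof -
      have "z \<in> D" using that by (auto simp: W_def D_def)
      then show ?thesis using min[of "(z, w')"] ww' by (simp add: J_def \<psi>_def)
    qed
    ultimately show ?thesis unfolding eventually_nhds by blast
  qed
  define P where "P = p - (2 * N * G w) *\<^sub>R (\<xi> - x)"
  have gw: "g w = (q - N * G w * C, P)"
    by (simp add: g_def w q_def p_def P_def algebra_simps)
  have sup: "0 \<le> q - N * G w * C + H P"
    using super C1 wQ touch gw unfolding viscosity_supersolution_def by fastforce
  have "(\<psi> has_derivative (\<lambda>h. g w \<bullet> h)) (at w)" using C1 wQ by (auto simp: C1_with_gradient_def)
  then have "norm (g w) \<le> \<Lambda>" by (rule gradient_bounded_if_touching_lipschitz_below[OF lip Q wQ _ touch])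
  then have P: "norm P \<le> \<Lambda>" using norm_snd_le[of P "q - N * G w * C"] by (simp add: gw)
  have "\<bar>(A *v P) \<bullet> (\<xi> - x)\<bar> \<le> norm (A *v P) * norm (\<xi> - x)" by (rule Cauchy_Schwarz_ineq2)
  also have "\<dots> \<le> (a * \<Lambda>) * r"
    using wr P a \<Lambda> by (intro mult_mono order_trans[OF normA] mult_left_mono) (auto simp: w)
  finally have "- ((A *v P) \<bullet> (\<xi> - x)) \<le> a * \<Lambda> * r" by linarith
  then have "2 * N * G w * (- ((A *v P) \<bullet> (\<xi> - x))) \<le> 2 * N * G w * (a * \<Lambda> * r)"
    using N G0 by (intro mult_left_mono) auto
  moreover have "H P + (A *v P) \<bullet> ((2 * N * G w) *\<^sub>R (\<xi> - x)) \<le> H p"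
    using H_subgradient[of P "(2 * N * G w) *\<^sub>R (\<xi> - x)"] by (simp add: P_def)
  ultimately have "0 \<le> N * G w * (2 * r * a * \<Lambda> - C)"
    using sup Vsub by (simp add: algebra_simps)
  moreover have "0 < N * G w" using N G0 by simp
  ultimately show False using C by (simp add: zero_le_mult_iff)
qed

text \<open>The limit \<open>\<kappa> \<rightarrow> 0\<close> of the preceding bound, by compactness of the ball of starting points.\<close>
lemma supersolution_hopf_lax_bound:
  fixes u :: "real \<times> (real^'n) \<Rightarrow> real"
  assumes super: "viscosity_supersolution H Q u" and lip: "\<Lambda>-lipschitz_on Q u" and Q: "open Q"
    and st: "s < t" and r: "0 < r"
    and normA: "\<And>p. norm (A *v p) \<le> a * norm p" and a: "0 \<le> a"
    and C: "2 * r * a * \<Lambda> < C" and cone: "C * (t - s) \<le> r\<^sup>2 / 2"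
    and cyl: "{s..t + r\<^sup>2 / (2 * C)} \<times> cball x r \<subseteq> Q"
  shows "\<exists>z\<in>cball x r. u (s, z) + L (x - z) / (t - s) \<le> u (t, x)"
proof -
  have "\<exists>z\<in>cball x r. u (s, z) + L (x - z) / (t - s + inverse (Suc n)) \<le> u (t, x)" for n
    using supersolution_regularized_bound[OF super lip Q st r _ normA a C cone cyl] by simp
  then obtain z where z: "\<And>n. z n \<in> cball x r"
      "\<And>n. u (s, z n) + L (x - z n) / (t - s + inverse (Suc n)) \<le> u (t, x)"
    by metis
  obtain l k where l: "l \<in> cball x r" "strict_mono k" "(z \<circ> k) \<longlonglongrightarrow> l"
    using z(1) compact_cball[of x r] unfolding compact_def by metis
  have "0 < C" using C r a lipschitz_on_nonneg[OF lip] by (smt (verit) mult_nonneg_nonneg)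
  then have sQ: "(s, y) \<in> Q" if "y \<in> cball x r" for y
    proof -
    have "0 \<le> r\<^sup>2 / (2 * C)" using \<open>0 < C\<close> by simp
    then have "(s, y) \<in> {s..t + r\<^sup>2 / (2 * C)} \<times> cball x r" using that st by auto
    then show ?thesis using cyl by blast
  qed
  have "continuous_on (cball x r) (\<lambda>y. u (s, y))"
    by (rule continuous_on_compose2[OF lipschitz_on_continuous_on[OF lip]]) (auto intro!: continuous_intros sQ)
  then have "(\<lambda>n. u (s, z (k n))) \<longlonglongrightarrow> u (s, l)"
    using continuous_on_tendsto_compose[of "cball x r" "\<lambda>y. u (s, y)" "z \<circ> k" l sequentially] l z(1)
    by (simp add: o_def)
  moreover have "(\<lambda>n. inverse (real (Suc (k n)))) \<longlonglongrightarrow> 0"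
    using LIMSEQ_subseq_LIMSEQ[OF LIMSEQ_inverse_real_of_nat l(2)] by (simp add: o_def)
  ultimately have "(\<lambda>n. u (s, z (k n)) + L (x - z (k n)) / (t - s + inverse (Suc (k n)))) \<longlonglongrightarrow>
      u (s, l) + L (x - l) / (t - s + 0)"
    using l(3) st by (intro tendsto_intros tendsto_L) (auto simp: o_def)
  then have "u (s, l) + L (x - l) / (t - s + 0) \<le> u (t, x)"
    by (rule LIMSEQ_le_const2) (use z(2) in auto)
  then show ?thesis using l(1) by auto
qed

end

section \<open>Minimizing velocities and differentiability\<close>

text \<open>All that is used from the equation near a point: the Hopf-Lax formula for one fixed duration \<open>a\<close>, attained with
velocities bounded by \<open>M\<close>. Minimizers are assumed for endpoints in the ball of radius \<open>r\<close>; the radius \<open>\<rho>\<close> leaves room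
for their starting points. The last assumption bounds the velocity of a maximizing step, where the gain \<open>L v\<close> is
balanced by the Lipschitz bound for \<open>u\<close>.\<close>
locale hopf_lax_region = quadratic_hamiltonian A for A :: "real^'n^'n" +
  fixes u :: "real \<times> (real^'n) \<Rightarrow> real" and c :: "real^'n" and \<rho> r a \<alpha> M \<Lambda> :: real
  assumes a: "0 < a" "a \<le> \<alpha>" and M: "0 < M" and r: "0 < r" "r + a * M < \<rho>"
    and lip: "\<Lambda>-lipschitz_on ({0<..} \<times> ball c \<rho>) u"
    and below: "\<And>s t x y. 0 < s \<Longrightarrow> s < t \<Longrightarrow> x \<in> ball c \<rho> \<Longrightarrow> y \<in> ball c \<rho> \<Longrightarrow>
      u (t, x) \<le> u (s, y) + L (x - y) / (t - s)"
    and attained: "\<And>t x. \<alpha> < t \<Longrightarrow> x \<in> ball c r \<Longrightarrow>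
      \<exists>v. norm v \<le> M \<and> u (t, x) = u (t - a, x - a *\<^sub>R v) + a * L v"
    and speed: "\<And>v. L v \<le> \<Lambda> * norm v \<Longrightarrow> norm v \<le> M"
begin

text \<open>The bound on the velocity belongs to the definition, so that minimizing velocities at converging points have
convergent subsequences.\<close>
definition min_velocities :: "real \<times> (real^'n) \<Rightarrow> (real^'n) set" where
  "min_velocities p = {v. norm v \<le> M \<and> u p = u (fst p - a, snd p - a *\<^sub>R v) + a * L v}"

definition region :: "(real \<times> (real^'n)) set" where
  "region = {\<alpha><..} \<times> ball c r"

text \<open>The largest admissible \<open>S\<close> is the square of the circumradius of the minimizing velocities in the norm \<open>sqrt (L v)\<close>.\<close>
definition spread :: "real \<Rightarrow> real \<times> (real^'n) \<Rightarrow> bool" where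
  "spread S p \<longleftrightarrow> (\<forall>w. \<exists>v\<in>min_velocities p. S \<le> L (w - v))"

lemma open_region: "open region"
  by (auto simp: region_def intro: open_Times)

lemma region_ball: "(t, x) \<in> region \<Longrightarrow> x \<in> ball c \<rho>"
  using r a M by (auto simp: region_def) (smt (verit) mult_pos_pos)

lemma foot: "(t, x) \<in> region \<Longrightarrow> norm v \<le> M \<Longrightarrow> 0 < t - a \<and> x - a *\<^sub>R v \<in> ball c \<rho>"
proof -
  assume tx: "(t, x) \<in> region" and v: "norm v \<le> M"
  have "dist c (x - a *\<^sub>R v) \<le> dist c x + a * norm v"
    using norm_triangle_ineq[of "c - x" "a *\<^sub>R v"] a by (simp add: dist_norm algebra_simps)
  also have "a * norm v \<le> a * M" using v a by simp
  finally show ?thesis using tx a r by (auto simp: region_def)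
qed

lemma min_velocities_nonempty: "p \<in> region \<Longrightarrow> \<exists>v. v \<in> min_velocities p"
  using attained[of "fst p" "snd p"] by (auto simp: region_def min_velocities_def)

lemma continuous_u: "continuous_on ({0<..} \<times> ball c \<rho>) u"
  by (rule lipschitz_on_continuous_on[OF lip])

text \<open>The start of a minimizing motion is a competitor for all nearby endpoints, so \<open>u\<close> is touched from above at \<open>(t, x)\<close>
by a smooth function.\<close>
lemma upper_action_bound:
  assumes "(t, x) \<in> region" "v \<in> min_velocities (t, x)" "t - a < t'" "x' \<in> ball c \<rho>"
  shows "u (t', x') \<le> u (t, x) + L (x' - x + a *\<^sub>R v) / (a + (t' - t)) - a * L v"
proof -
  have v: "norm v \<le> M" "u (t, x) = u (t - a, x - a *\<^sub>R v) + a * L v"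
    using assms(2) by (auto simp: min_velocities_def)
  show ?thesis
    using below[of "t - a" t' x' "x - a *\<^sub>R v"] foot[OF assms(1) v(1)] assms(3,4) v(2)
    by (simp add: algebra_simps)
qed

lemma min_velocities_limit:
  assumes p: "P \<longlonglongrightarrow> p" "\<And>n. P n \<in> region" "p \<in> region" and v: "\<And>n. v n \<in> min_velocities (P n)"
  obtains l k where "l \<in> min_velocities p" "strict_mono (k::nat \<Rightarrow> nat)" "(\<lambda>n. v (k n)) \<longlonglongrightarrow> l"
proof -
  have vM: "v n \<in> cball 0 M" for n using v[of n] by (auto simp: min_velocities_def)
  then obtain l k where l: "l \<in> cball 0 M" "strict_mono k" "(v \<circ> k) \<longlonglongrightarrow> l"
    using compact_cball[of 0 M] unfolding compact_def by metis
  then have vk: "(\<lambda>n. v (k n)) \<longlonglongrightarrow> l" by (simp add: o_def)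
  have Pk: "(\<lambda>n. P (k n)) \<longlonglongrightarrow> p" using LIMSEQ_subseq_LIMSEQ[OF p(1) l(2)] by (simp add: o_def)
  have cont: "isCont u q" if "q \<in> {0<..} \<times> ball c \<rho>" for q
    using continuous_u that by (cases q) (simp add: continuous_on_eq_continuous_at open_Times)
  have pin: "p \<in> {0<..} \<times> ball c \<rho>"
    using p(3) a region_ball by (cases p) (auto simp: region_def)
  have "(fst p - a, snd p - a *\<^sub>R l) \<in> {0<..} \<times> ball c \<rho>"
    using foot[of "fst p" "snd p" l] p(3) l(1) by auto
  then have lim: "(\<lambda>n. u (fst (P (k n)) - a, snd (P (k n)) - a *\<^sub>R v (k n)) + a * L (v (k n)))
      \<longlonglongrightarrow> u (fst p - a, snd p - a *\<^sub>R l) + a * L l"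
    by (intro tendsto_add tendsto_mult tendsto_const tendsto_L vk isCont_tendsto_compose[OF cont]
        tendsto_Pair tendsto_diff tendsto_fst tendsto_snd tendsto_scaleR Pk)
  have lim': "(\<lambda>n. u (P (k n))) \<longlonglongrightarrow> u p" by (rule isCont_tendsto_compose[OF cont[OF pin] Pk])
  have "u (fst (P (k n)) - a, snd (P (k n)) - a *\<^sub>R v (k n)) + a * L (v (k n)) = u (P (k n))" for n
    using v[of "k n"] by (simp add: min_velocities_def)
  then have "u p = u (fst p - a, snd p - a *\<^sub>R l) + a * L l"
    using LIMSEQ_unique[OF lim'] lim by simp
  then have "l \<in> min_velocities p" using l(1) by (simp add: min_velocities_def)
  then show ?thesis using that l(2) vk by blast
qed

lemma spread_mono: "spread S p \<Longrightarrow> S' \<le> S \<Longrightarrow> spread S' p"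
  unfolding spread_def by (meson order_trans)

lemma spread_limit:
  assumes "P \<longlonglongrightarrow> p" "\<And>n. P n \<in> region" "p \<in> region" "\<And>n. spread S (P n)"
  shows "spread S p"
  unfolding spread_def
proof
  fix w
  have "\<forall>n. \<exists>v. v \<in> min_velocities (P n) \<and> S \<le> L (w - v)"
    using assms(4) unfolding spread_def by blast
  then obtain v where v: "\<And>n. v n \<in> min_velocities (P n)" "\<And>n. S \<le> L (w - v n)"
    by metis
  obtain l k where l: "l \<in> min_velocities p" "strict_mono k" "(\<lambda>n. v (k n)) \<longlonglongrightarrow> l"
    using min_velocities_limit[OF assms(1-3) v(1)] by blast
  have "(\<lambda>n. L (w - v (k n))) \<longlonglongrightarrow> L (w - l)" by (intro tendsto_L tendsto_diff tendsto_const l)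
  then have "S \<le> L (w - l)" by (rule LIMSEQ_le_const) (use v(2) in auto)
  then show "\<exists>v\<in>min_velocities p. S \<le> L (w - v)" using l(1) by blast
qed

text \<open>The derivative of \<open>u\<close> must agree with that of each smooth function touching \<open>u\<close> from above.\<close>
lemma spatial_derivative:
  assumes tx: "(t, x) \<in> region" and v: "v \<in> min_velocities (t, x)"
    and der: "(u has_derivative f) (at (t, x))"
  shows "f (0, \<xi>) = B v \<xi>"
proof -
  define \<phi> where "\<phi> \<theta> = u (t, x + \<theta> *\<^sub>R \<xi>) - \<theta> * B v \<xi> - \<theta>\<^sup>2 * (L \<xi> / a)" for \<theta>
  have inner: "((\<lambda>\<theta>. (t, x + \<theta> *\<^sub>R \<xi>)) has_derivative (\<lambda>\<theta>. (0, \<theta> *\<^sub>R \<xi>))) (at 0)"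
    by (auto intro!: derivative_eq_intros)
  have "((\<lambda>\<theta>. u (t, x + \<theta> *\<^sub>R \<xi>)) has_derivative (\<lambda>\<theta>. f (0, \<theta> *\<^sub>R \<xi>))) (at 0)"
    using has_derivative_compose[OF inner, of u f] der by simp
  moreover have "f (0, \<theta> *\<^sub>R \<xi>) = \<theta> * f (0, \<xi>)" for \<theta>
    using linear_scale[OF has_derivative_linear[OF der], of \<theta> "(0, \<xi>)"] by simp
  ultimately have "((\<lambda>\<theta>. u (t, x + \<theta> *\<^sub>R \<xi>)) has_real_derivative f (0, \<xi>)) (at 0)"
    by (simp add: has_field_derivative_def mult.commute[of _ "f (0, \<xi>)"])
  then have der0: "(\<phi> has_real_derivative f (0, \<xi>) - B v \<xi>) (at 0)"
    unfolding \<phi>_def using a by (auto intro!: derivative_eq_intros)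
  have "open {\<theta>. x + \<theta> *\<^sub>R \<xi> \<in> ball c \<rho>}"
    unfolding mem_ball by (intro open_Collect_less continuous_intros)
  moreover have "0 \<in> {\<theta>. x + \<theta> *\<^sub>R \<xi> \<in> ball c \<rho>}" using region_ball[OF tx] by simp
  ultimately obtain d where d: "0 < d" "ball 0 d \<subseteq> {\<theta>. x + \<theta> *\<^sub>R \<xi> \<in> ball c \<rho>}"
    using open_contains_ball by blast
  then have ball: "x + \<theta> *\<^sub>R \<xi> \<in> ball c \<rho>" if "\<bar>\<theta>\<bar> < d" for \<theta>
    using that by (auto simp: subset_iff dist_real_def)
  have "\<phi> \<theta> \<le> \<phi> 0" if "\<bar>\<theta>\<bar> < d" for \<theta>
    using upper_action_bound[OF tx v, of t "x + \<theta> *\<^sub>R \<xi>"] ball[OF that] a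
      action_shift[of a 0 "\<theta> *\<^sub>R \<xi>" v]
    by (simp add: \<phi>_def B_simps L_scale)
  then have "f (0, \<xi>) - B v \<xi> = 0"
    using d(1) by (intro DERIV_local_max[OF der0]) auto
  then show ?thesis by simp
qed

text \<open>Two different minimizing velocities would give two different derivatives.\<close>
lemma spread_imp_not_differentiable:
  assumes p: "p \<in> region" and S: "spread S p" "0 < S"
  shows "\<not> u differentiable (at p)"
proof
  assume "u differentiable (at p)"
  then obtain f where f: "(u has_derivative f) (at p)" by (auto simp: differentiable_def)
  obtain t x where tx: "p = (t, x)" by fastforce
  obtain w where w: "w \<in> min_velocities p" using min_velocities_nonempty[OF p] by blast
  obtain v where v: "v \<in> min_velocities p" "S \<le> L (w - v)" using S(1) unfolding spread_def by blast
  have "B w (w - v) = B v (w - v)"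
    using spatial_derivative[of t x w f "w - v"] spatial_derivative[of t x v f "w - v"] p w v f by (simp add: tx)
  then have "L (w - v) = 0" by (simp add: L_eq_B B_diff_left)
  then show False using v S by simp
qed

text \<open>A ball containing two points has at least half their distance as its radius; hence the factor \<open>1/4\<close> for the square.\<close>
lemma spread_if_not_unique:
  assumes "v1 \<in> min_velocities p" "v2 \<in> min_velocities p"
  shows "spread (L (v1 - v2) / 4) p"
  unfolding spread_def
proof
  fix w
  have "L (v1 - v2) = L ((w - v2) - (w - v1))" by simp
  also have "\<dots> \<le> 2 * L (w - v2) + 2 * L (w - v1)"
    using L_nonneg[of "(w - v2) + (w - v1)"] L_diff[of "w - v2" "w - v1"] L_add[of "w - v2" "w - v1"]
    by linarith
  finally have "L (v1 - v2) / 4 \<le> L (w - v1) \<or> L (v1 - v2) / 4 \<le> L (w - v2)" by linarith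
  then show "\<exists>v\<in>min_velocities p. L (v1 - v2) / 4 \<le> L (w - v)" using assms by blast
qed

lemma min_velocities_near_unique:
  assumes p: "p \<in> region" and unique: "min_velocities p = {v}" and g: "continuous_on UNIV g" and e: "g v < (e::real)"
  shows "\<exists>d>0. \<forall>q. dist q p < d \<longrightarrow> q \<in> region \<and> (\<forall>v'\<in>min_velocities q. g v' < e)"
proof (rule ccontr)
  assume contra: "\<not> ?thesis"
  obtain d0 where d0: "0 < d0" "\<And>q. dist q p < d0 \<Longrightarrow> q \<in> region"
    using open_region p unfolding open_dist by blast
  have "\<exists>q v'. dist q p < min d0 (inverse (Suc n)) \<and> v' \<in> min_velocities q \<and> e \<le> g v'" for n
    using contra d0 by (metis inverse_positive_iff_positive min_less_iff_conj not_less of_nat_0_less_iff zero_less_Suc)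
  then obtain Q V where QV: "\<And>n. dist (Q n) p < min d0 (inverse (Suc n))" "\<And>n. V n \<in> min_velocities (Q n)"
      "\<And>n. e \<le> g (V n)"
    by metis
  have "(\<lambda>n. dist (Q n) p) \<longlonglongrightarrow> 0"
    using QV(1) by (intro tendsto_sandwich[OF _ _ tendsto_const LIMSEQ_inverse_real_of_nat]) (auto intro!: always_eventually less_imp_le)
  then have "Q \<longlonglongrightarrow> p" by (rule iffD2[OF tendsto_dist_iff])
  moreover have "Q n \<in> region" for n using QV(1)[of n] d0(2) by simp
  ultimately obtain l k where l: "l \<in> min_velocities p" "strict_mono k" "(\<lambda>n. V (k n)) \<longlonglongrightarrow> l"
    using min_velocities_limit[of Q p V] p QV(2) by blast
  have "(\<lambda>n. g (V (k n))) \<longlonglongrightarrow> g l" 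
    using g by (intro isCont_tendsto_compose[OF _ l(3)]) (simp add: continuous_on_eq_continuous_at)
  then have "e \<le> g l" by (rule LIMSEQ_le_const) (use QV(3) in auto)
  then show False using l(1) unique e by simp
qed

text \<open>The bound from above at \<open>(t, x)\<close> has the gradient \<open>D v\<close>. The bounds from above at a nearby point, evaluated at \<open>(t, x)\<close>,
give bounds from below with the gradients \<open>D v'\<close>, and \<open>v'\<close> is close to \<open>v\<close> as \<open>v\<close> is the only possible limit.\<close>
lemma differentiable_if_unique:
  assumes tx: "(t, x) \<in> region" and unique: "min_velocities (t, x) = {v}"
  shows "u differentiable (at (t, x))"
proof -
  obtain b where b: "0 < b" "\<And>v w. \<bar>B v w\<bar> \<le> b * norm v * norm w" using B_bounded by blast
  define D where "D v h = B v (snd h) - fst h * L v" for v and h :: "real \<times> (real^'n)"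
  define R where "R = b * (1 + M)\<^sup>2 / a"
  have R: "0 < R" using a b M by (simp add: R_def add_pos_pos)
  have vM: "norm v \<le> M" using unique by (auto simp: min_velocities_def)
  have remainder: "L (snd h - fst h *\<^sub>R v') / a' \<le> R * (norm h)\<^sup>2" if "norm v' \<le> M" "a / 2 \<le> a'" for v' h a'
  proof -
    have h: "norm (snd h) \<le> norm h" "\<bar>fst h\<bar> \<le> norm h"
      using norm_snd_le[of "snd h" "fst h"] norm_fst_le[of "fst h" "snd h"] by auto
    have "norm (snd h - fst h *\<^sub>R v') \<le> norm (snd h) + \<bar>fst h\<bar> * norm v'"
      using norm_triangle_ineq4[of "snd h" "fst h *\<^sub>R v'"] by simp
    also have "\<dots> \<le> norm h + norm h * M" using h that by (intro add_mono mult_mono) auto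
    finally have n: "norm (snd h - fst h *\<^sub>R v') \<le> (1 + M) * norm h" by (simp add: algebra_simps)
    have "L (snd h - fst h *\<^sub>R v') \<le> b / 2 * (norm (snd h - fst h *\<^sub>R v'))\<^sup>2"
      using b(2)[of "snd h - fst h *\<^sub>R v'" "snd h - fst h *\<^sub>R v'"] by (simp add: L_eq_B power2_eq_square)
    also have "\<dots> \<le> b / 2 * ((1 + M) * norm h)\<^sup>2"
      using n b by (intro mult_left_mono power_mono) auto
    finally have "L (snd h - fst h *\<^sub>R v') / a' \<le> (b / 2 * ((1 + M) * norm h)\<^sup>2) / (a / 2)"
      using that a b L_nonneg by (intro frac_le) auto
    then show ?thesis by (simp add: R_def power_mult_distrib)
  qed
  have "(u has_derivative D v) (at (t, x))"
    unfolding has_derivative_at_alt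
  proof (intro conjI allI impI)
    have "linear (D v)"
      by (rule linearI) (auto simp: D_def B_simps algebra_simps)
    then show "bounded_linear (D v)" by (simp add: linear_conv_bounded_linear)
    fix e :: real assume e: "0 < e"
    define g where "g v' = b * norm (v' - v) + \<bar>L v' - L v\<bar>" for v'
    have "continuous_on UNIV g" unfolding g_def by (intro continuous_intros)
    moreover have "g v < e / 2" using e by (simp add: g_def)
    ultimately obtain d0 where d0: "0 < d0" "\<And>q. dist q (t, x) < d0 \<Longrightarrow> q \<in> region"
      "\<And>q v'. dist q (t, x) < d0 \<Longrightarrow> v' \<in> min_velocities q \<Longrightarrow> g v' < e / 2"
      using min_velocities_near_unique[OF tx unique] by metis
    define d where "d = min d0 (min (a / 2) (e / (2 * R)))"
    have d: "0 < d" using d0 a e R by (simp add: d_def)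
    have "norm (u y - u (t, x) - D v (y - (t, x))) \<le> e * norm (y - (t, x))" if y: "norm (y - (t, x)) < d" for y
    proof -
      obtain t' x' where y': "y = (t', x')" by fastforce
      define h where "h = y - (t, x)"
      have h: "fst h = t' - t" "snd h = x' - x" by (auto simp: h_def y')
      have yd: "dist y (t, x) < d0" "norm h < a / 2" "norm h \<le> e / (2 * R)"
        using y by (auto simp: d_def dist_norm h_def)
      have tt: "\<bar>t' - t\<bar> < a / 2" 
        using yd(2) norm_fst_le[of "fst h" "snd h"] unfolding prod.collapse by (simp add: h)
      then have tt': "t - a < t'" "0 < a + (t' - t)" "t' - a < t" "0 < a + (t - t')"
        and tt'': "a / 2 \<le> a + (t' - t)" "a / 2 \<le> a - (t' - t)"
        using a(1) by linarith+
      obtain v' where v': "v' \<in> min_velocities y" using min_velocities_nonempty[OF d0(2)[OF yd(1)]] by blast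
      have v'M: "norm v' \<le> M" using v' by (auto simp: min_velocities_def)
      have yreg: "(t', x') \<in> region" using d0(2)[OF yd(1)] y' by simp
      have "R * (norm h)\<^sup>2 \<le> (R * (e / (2 * R))) * norm h"
        using mult_right_mono[OF mult_left_mono[OF yd(3), of R], of "norm h"] R by (simp add: power2_eq_square mult.assoc)
      then have small: "R * (norm h)\<^sup>2 \<le> e / 2 * norm h" using R by simp
      have "u y \<le> u (t, x) + D v h + L (snd h - fst h *\<^sub>R v) / (a + (t' - t))"
        using upper_action_bound[OF tx _ tt'(1) region_ball[OF yreg], of v] unique
          action_shift[OF a(1) tt'(2), of "x' - x" v] by (simp add: D_def h y')
      also have "\<dots> \<le> u (t, x) + D v h + R * (norm h)\<^sup>2"
        by (intro add_left_mono remainder vM tt'')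
      finally have upper: "u y - u (t, x) - D v h \<le> e / 2 * norm h" using small by linarith
      have "u (t, x) \<le> u y - D v' h + L (snd h - fst h *\<^sub>R v') / (a - (t' - t))"
      proof -
        have flip: "L (snd h - fst h *\<^sub>R v') = L (x - x' - (t - t') *\<^sub>R v')"
          using L_minus[of "snd h - fst h *\<^sub>R v'"] by (simp add: h algebra_simps)
        have "D v' h = - (B v' (x - x') - (t - t') * L v')" by (simp add: D_def h B_simps algebra_simps)
        moreover have den: "a - (t' - t) = a + (t - t')" by simp
        ultimately show ?thesis
          using upper_action_bound[OF yreg v'[unfolded y'] tt'(3) region_ball[OF tx]]
            action_shift[OF a(1) tt'(4), of "x - x'" v'] unfolding y' flip den by linarith
      qed
      also have "\<dots> \<le> u y - D v' h + R * (norm h)\<^sup>2"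
        by (intro add_left_mono remainder v'M tt'')
      finally have lower: "D v' h - e / 2 * norm h \<le> u y - u (t, x)" using small by linarith
      have "\<bar>D v' h - D v h\<bar> = \<bar>B (v' - v) (snd h) - fst h * (L v' - L v)\<bar>"
        by (simp add: D_def B_simps algebra_simps)
      also have "\<dots> \<le> b * norm (v' - v) * norm (snd h) + \<bar>fst h\<bar> * \<bar>L v' - L v\<bar>"
        using b(2)[of "v' - v" "snd h"] abs_triangle_ineq4[of "B (v' - v) (snd h)" "fst h * (L v' - L v)"]
        unfolding abs_mult by linarith
      also have "\<dots> \<le> b * norm (v' - v) * norm h + norm h * \<bar>L v' - L v\<bar>"
        using norm_snd_le[of "snd h" "fst h"] norm_fst_le[of "fst h" "snd h"] b
        by (intro add_mono mult_left_mono mult_right_mono) auto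
      also have "\<dots> = g v' * norm h" by (simp add: g_def algebra_simps)
      also have "\<dots> \<le> e / 2 * norm h" using d0(3)[OF yd(1) v'] by (intro mult_right_mono) auto
      finally have "\<bar>D v' h - D v h\<bar> \<le> e / 2 * norm h" .
      moreover have "0 \<le> e / 2 * norm h" using e by simp
      moreover have "e * norm h = e / 2 * norm h + e / 2 * norm h" by simp
      ultimately have "\<bar>u y - u (t, x) - D v h\<bar> \<le> e * norm h" using upper lower by linarith
      then show ?thesis unfolding h_def real_norm_def .
    qed
    then show "\<exists>d>0. \<forall>y. norm (y - (t, x)) < d \<longrightarrow> norm (u y - u (t, x) - D v (y - (t, x))) \<le> e * norm (y - (t, x))"
      using d by blast
  qed
  then show ?thesis by (auto simp: differentiable_def)
qed

lemma not_differentiable_imp_spread: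
  assumes "p \<in> region" "\<not> u differentiable (at p)"
  obtains S where "0 < S" "spread S p"
proof -
  obtain v1 where v1: "v1 \<in> min_velocities p" using min_velocities_nonempty[OF assms(1)] by blast
  have "min_velocities p \<noteq> {v1}"
    using differentiable_if_unique[of "fst p" "snd p" v1] assms by auto
  then obtain v2 where v2: "v2 \<in> min_velocities p" "v1 \<noteq> v2" using v1 by blast
  then have "0 < L (v1 - v2) / 4" using L_pos[of "v1 - v2"] by simp
  then show ?thesis using that spread_if_not_unique[OF v1 v2(1)] by blast
qed

end

section \<open>Forward propagation of the spread\<close>

text \<open>A variant of the theorem of Arzela and Ascoli for functions that need not be continuous, such as the piecewise
constant interpolations of discrete trajectories.\<close>
lemma almost_lipschitz_subsequence:
  fixes f :: "nat \<Rightarrow> real \<Rightarrow> 'b::{real_normed_vector,heine_borel}"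
  assumes T: "0 < T" and bounded: "\<And>n s. s \<in> {0..T} \<Longrightarrow> norm (f n s) \<le> R"
    and almost: "\<And>n s s'. s \<in> {0..T} \<Longrightarrow> s' \<in> {0..T} \<Longrightarrow> norm (f n s - f n s') \<le> M * (\<bar>s - s'\<bar> + \<epsilon> n)"
    and \<epsilon>: "\<epsilon> \<longlonglongrightarrow> 0" and M: "0 < M"
  obtains k g where "strict_mono (k::nat \<Rightarrow> nat)" "\<And>s. s \<in> {0..T} \<Longrightarrow> (\<lambda>n. f (k n) s) \<longlonglongrightarrow> g s"
    "M-lipschitz_on {0..T} g"
proof -
  define S where "S = {0..T} \<inter> \<rat>"
  have "countable S" unfolding S_def by (simp add: countable_rat)
  then obtain k where k: "strict_mono k" "\<And>s. s \<in> S \<Longrightarrow> \<exists>l. (\<lambda>n. f (k n) s) \<longlonglongrightarrow> l"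
    using function_convergent_subsequence[of S f R] bounded by (metis S_def IntD1)
  have \<epsilon>k: "(\<lambda>n. \<epsilon> (k n)) \<longlonglongrightarrow> 0"
    using LIMSEQ_subseq_LIMSEQ[OF \<epsilon> k(1)] by (simp add: o_def)
  have "convergent (\<lambda>n. f (k n) s)" if s: "s \<in> {0..T}" for s
  proof -
    have "Cauchy (\<lambda>n. f (k n) s)"
    proof (rule metric_CauchyI)
      fix e :: real assume "0 < e"
      define d where "d = e / (8 * M)"
      have d: "0 < d" "M * (2 * d) = e / 4" using \<open>0 < e\<close> M by (auto simp: d_def)
      have "max 0 (s - d) < min T (s + d)" using s T d by auto
      then obtain s' where s': "s' \<in> \<rat>" "max 0 (s - d) < s'" "s' < min T (s + d)"
        using Rats_dense_in_real by blast
      then have S: "s' \<in> {0..T}" "s' \<in> S" "\<bar>s - s'\<bar> < d" by (auto simp: S_def)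
      then have "Cauchy (\<lambda>n. f (k n) s')" using k(2) LIMSEQ_imp_Cauchy by blast
      then obtain N1 where N1: "\<And>m n. N1 \<le> m \<Longrightarrow> N1 \<le> n \<Longrightarrow> dist (f (k m) s') (f (k n) s') < e / 4"
        using metric_CauchyD[of _ "e / 4"] \<open>0 < e\<close> by (metis zero_less_divide_iff zero_less_numeral)
      obtain N2 where N2: "\<And>n. N2 \<le> n \<Longrightarrow> \<epsilon> (k n) < d"
        using order_tendstoD(2)[OF \<epsilon>k d(1)] by (auto simp: eventually_sequentially)
      have near: "dist (f (k n) s) (f (k n) s') < e / 4" if "N2 \<le> n" for n
      proof -
        have "dist (f (k n) s) (f (k n) s') \<le> M * (\<bar>s - s'\<bar> + \<epsilon> (k n))"
          using almost[OF s S(1)] by (simp add: dist_norm)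
        also have "\<dots> < M * (2 * d)" using N2[OF that] S(3) M by (intro mult_strict_left_mono) auto
        finally show ?thesis using d by simp
      qed
      show "\<exists>N. \<forall>m\<ge>N. \<forall>n\<ge>N. dist (f (k m) s) (f (k n) s) < e"
      proof (intro exI[of _ "max N1 N2"] allI impI)
        fix m n assume "max N1 N2 \<le> m" "max N1 N2 \<le> n"
        then have mn: "N1 \<le> m" "N2 \<le> m" "N1 \<le> n" "N2 \<le> n" by auto
        have "dist (f (k m) s) (f (k n) s) \<le> dist (f (k m) s) (f (k m) s') + dist (f (k m) s') (f (k n) s')
            + dist (f (k n) s) (f (k n) s')"
          using dist_triangle[of "f (k m) s" "f (k n) s" "f (k m) s'"]
            dist_triangle2[of "f (k m) s'" "f (k n) s" "f (k n) s'"] by linarith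
        then show "dist (f (k m) s) (f (k n) s) < e"
          using near[OF mn(2)] near[OF mn(4)] N1[OF mn(1,3)] \<open>0 < e\<close> by linarith
      qed
    qed
    then show ?thesis by (simp add: Cauchy_convergent_iff)
  qed
  then obtain g where g: "\<And>s. s \<in> {0..T} \<Longrightarrow> (\<lambda>n. f (k n) s) \<longlonglongrightarrow> g s"
    unfolding convergent_def by metis
  have "M-lipschitz_on {0..T} g"
  proof (rule lipschitz_onI)
    fix s s' assume ss: "s \<in> {0..T}" "s' \<in> {0..T}"
    have "(\<lambda>n. dist (f (k n) s) (f (k n) s')) \<longlonglongrightarrow> dist (g s) (g s')"
      using g ss by (intro tendsto_dist)
    moreover have "(\<lambda>n. M * (\<bar>s - s'\<bar> + \<epsilon> (k n))) \<longlonglongrightarrow> M * (\<bar>s - s'\<bar> + 0)"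
      by (intro tendsto_intros \<epsilon>k)
    ultimately show "dist (g s) (g s') \<le> M * dist s s'"
      using almost[OF ss] by (auto simp: dist_norm dist_real_def intro!: LIMSEQ_le)
  qed (use M in simp)
  then show ?thesis using that k(1) g by blast
qed

context hopf_lax_region begin

lemma region_subset: "region \<subseteq> {0<..} \<times> ball c \<rho>"
  using a region_ball by (auto simp: region_def)

text \<open>The upper bound issued from \<open>(t, x)\<close> is evaluated at \<open>(t + h, x + h w)\<close> and vice versa. In the sum of the two
inequalities the values of \<open>u\<close> and the action \<open>h L w\<close> cancel. The point \<open>x + h w\<close> is arbitrary here.\<close>
lemma defect_comparison:
  assumes tx: "(t, x) \<in> region" and ty: "(t + h, x + h *\<^sub>R w) \<in> region" and h: "0 < h" "h < a"
    and v: "v \<in> min_velocities (t, x)" and v': "v' \<in> min_velocities (t + h, x + h *\<^sub>R w)"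
  shows "(a - h) / (a + h) * L (w - v) \<le> L (w - v')"
proof -
  have "u (t + h, x + h *\<^sub>R w) \<le> u (t, x) + h * L w - h * (a / (a + h)) * L (w - v)"
    using upper_action_bound[OF tx v, of "t + h" "x + h *\<^sub>R w"] region_ball[OF ty] h
      action_shift_straight[of a h w v] by simp
  moreover have "u (t, x) \<le> u (t + h, x + h *\<^sub>R w) - h * L w + h * (a / (a - h)) * L (w - v')"
    using upper_action_bound[OF ty v', of t x] region_ball[OF tx] h
      action_shift_straight[of a "- h" w v'] by simp
  ultimately have "h * (a / (a + h)) * L (w - v) \<le> h * (a / (a - h)) * L (w - v')" by linarith
  then have "h * a * (L (w - v) / (a + h)) \<le> h * a * (L (w - v') / (a - h))" by simp
  then have "L (w - v) / (a + h) \<le> L (w - v') / (a - h)"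
    by (rule mult_left_le_imp_le) (use h a in simp)
  then show ?thesis using h by (simp add: field_simps)
qed

text \<open>This says that \<open>w\<close> lies in the convex hull of the minimizing velocities at its endpoint, in the form in which it is
used: no linear functional separates them. The values of \<open>u\<close> at the points \<open>y + \<theta> e\<close> are bounded from below by their
minimizing velocities and from above by maximality; then \<open>\<theta>\<close> tends to zero.\<close>
lemma maximizer_velocity:
  assumes ty: "(t', x + h *\<^sub>R w) \<in> region" and h: "0 < h"
    and max: "\<forall>\<^sub>F y in nhds (x + h *\<^sub>R w). u (t', y) - L (y - x) / h \<le> u (t', x + h *\<^sub>R w) - h * L w"
  shows "\<exists>v\<in>min_velocities (t', x + h *\<^sub>R w). B v e \<le> B w e"
proof -
  define y where "y = x + h *\<^sub>R w"
  have "\<forall>\<^sub>F z in nhds y. z \<in> ball c r"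
    using ty by (intro eventually_nhds_in_open) (auto simp: region_def y_def)
  with max have "\<forall>\<^sub>F z in nhds y. u (t', z) - L (z - x) / h \<le> u (t', y) - h * L w \<and> z \<in> ball c r"
    unfolding y_def[symmetric] by eventually_elim auto
  then obtain d where d: "0 < d" "\<And>z. dist z y < d \<Longrightarrow> u (t', z) - L (z - x) / h \<le> u (t', y) - h * L w \<and> z \<in> ball c r"
    unfolding eventually_nhds_metric by blast
  define \<theta>0 where "\<theta>0 = d / (1 + norm e)"
  have \<theta>0: "0 < \<theta>0" using d by (simp add: \<theta>0_def add_pos_nonneg)
  define \<theta> where "\<theta> n = \<theta>0 * inverse (real (Suc n))" for n
  have \<theta>: "0 < \<theta> n" "\<theta> n * norm e < d" for n
  proof -
    show "0 < \<theta> n" using \<theta>0 by (simp add: \<theta>_def)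
    have "\<theta> n \<le> \<theta>0" using \<theta>0 by (simp add: \<theta>_def mult_le_cancel_left1 inverse_le_1_iff)
    then have "\<theta> n * norm e \<le> \<theta>0 * norm e" by (intro mult_right_mono) auto
    also have "\<dots> < \<theta>0 * (1 + norm e)" using \<theta>0 by simp
    also have "\<dots> = d" by (simp add: \<theta>0_def add_nonneg_eq_0_iff)
    finally show "\<theta> n * norm e < d" .
  qed
  have lim\<theta>: "\<theta> \<longlonglongrightarrow> 0"
    unfolding \<theta>_def using tendsto_mult[OF tendsto_const LIMSEQ_inverse_real_of_nat, of \<theta>0] by simp
  define P where "P n = (t', y + \<theta> n *\<^sub>R e)" for n
  have near: "u (P n) - L (y + \<theta> n *\<^sub>R e - x) / h \<le> u (t', y) - h * L w" "P n \<in> region" for n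
    using d(2)[of "y + \<theta> n *\<^sub>R e"] \<theta>[of n] ty by (auto simp: P_def dist_norm region_def)
  obtain v where v: "\<And>n. v n \<in> min_velocities (P n)" using min_velocities_nonempty[OF near(2)] by metis
  have yreg: "(t', y) \<in> region" using ty by (simp add: y_def)
  have ineq: "B (v n) e \<le> B w e + \<theta> n * (L e / a + L e / h)" for n
  proof -
    have "u (t', y) \<le> u (P n) + L (a *\<^sub>R v n - \<theta> n *\<^sub>R e) / a - a * L (v n)"
      using upper_action_bound[of t' "y + \<theta> n *\<^sub>R e" "v n" t' y] near(2)[of n] v[of n] a region_ball[OF yreg]
      by (simp add: P_def)
    also have "L (a *\<^sub>R v n - \<theta> n *\<^sub>R e) / a - a * L (v n) = - \<theta> n * B (v n) e + (\<theta> n)\<^sup>2 * (L e / a)"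
      using a by (simp add: L_diff L_scale B_simps field_simps power2_eq_square)
    then have "u (P n) + L (a *\<^sub>R v n - \<theta> n *\<^sub>R e) / a - a * L (v n)
        = u (P n) - \<theta> n * B (v n) e + (\<theta> n)\<^sup>2 * (L e / a)" by simp
    finally have "u (t', y) \<le> u (P n) - \<theta> n * B (v n) e + (\<theta> n)\<^sup>2 * (L e / a)" .
    moreover have "L (y + \<theta> n *\<^sub>R e - x) / h = h * L w + \<theta> n * B w e + (\<theta> n)\<^sup>2 * (L e / h)"
      using h by (simp add: y_def L_add L_scale B_simps field_simps power2_eq_square)
    ultimately have "\<theta> n * B (v n) e \<le> \<theta> n * B w e + (\<theta> n)\<^sup>2 * (L e / a) + (\<theta> n)\<^sup>2 * (L e / h)"
      using near(1)[of n] by linarith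
    also have "\<dots> = \<theta> n * (B w e + \<theta> n * (L e / a + L e / h))"
      by (simp add: algebra_simps power2_eq_square)
    finally show ?thesis using \<theta>(1)[of n] by simp
  qed
  have "P \<longlonglongrightarrow> (t', y)"
  proof -
    have "P \<longlonglongrightarrow> (t', y + 0 *\<^sub>R e)"
      unfolding P_def by (intro tendsto_intros lim\<theta>)
    then show ?thesis by simp
  qed
  then obtain l k where l: "l \<in> min_velocities (t', y)" "strict_mono k" "(\<lambda>n. v (k n)) \<longlonglongrightarrow> l"
    using min_velocities_limit[of P "(t', y)" v] near(2) yreg v by blast
  have "(\<lambda>n. \<theta> (k n)) \<longlonglongrightarrow> 0" using LIMSEQ_subseq_LIMSEQ[OF lim\<theta> l(2)] by (simp add: o_def)
  then have "(\<lambda>n. B w e + \<theta> (k n) * (L e / a + L e / h)) \<longlonglongrightarrow> B w e + 0 * (L e / a + L e / h)"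
    by (intro tendsto_intros)
  moreover have "(\<lambda>n. B (v (k n)) e) \<longlonglongrightarrow> B l e" by (intro tendsto_B tendsto_const l)
  ultimately have "B l e \<le> B w e" using ineq by (auto intro: LIMSEQ_le)
  then show ?thesis using l(1) unfolding y_def by blast
qed

text \<open>Let \<open>v'\<close> be a minimizing velocity on the far side of \<open>w\<close> as seen from \<open>z\<close>. The angle at \<open>w\<close> is then not acute, whence
\<open>L (z - v') \<ge> L (w - v')\<close>, and \<open>L (w - v')\<close> is bounded from below by the spread at the previous point.\<close>
lemma spread_step:
  assumes tx: "(t, x) \<in> region" and h: "0 < h" "h < a" and S: "spread S (t, x)" "0 \<le> S"
    and room: "cball x (2 * M * h) \<subseteq> ball c r"
  shows "\<exists>y. norm (y - x) \<le> M * h \<and> spread ((a - h) / (a + h) * S) (t + h, y)"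
proof -
  define F where "F y = u (t + h, y) - L (y - x) / h" for y
  have reg: "(t + h, y) \<in> region" if "y \<in> cball x (2 * M * h)" for y
    using that room tx h by (auto simp: region_def)
  have Mh: "0 < M * h" using M h by simp
  have "continuous_on (cball x (2 * M * h)) F"
  proof -
    have "(\<lambda>y. (t + h, y)) ` cball x (2 * M * h) \<subseteq> {0<..} \<times> ball c \<rho>"
      using reg region_subset by blast
    then have "continuous_on (cball x (2 * M * h)) (\<lambda>y. u (t + h, y))"
      by (intro continuous_on_compose2[OF continuous_u] continuous_intros)
    then show ?thesis unfolding F_def using h by (intro continuous_intros) auto
  qed
  moreover have "cball x (2 * M * h) \<noteq> {}" using Mh by simp
  ultimately obtain y where y: "y \<in> cball x (2 * M * h)" "\<And>z. z \<in> cball x (2 * M * h) \<Longrightarrow> F z \<le> F y"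
    using continuous_attains_sup[OF compact_cball, of x "2 * M * h" F] by blast
  define w where "w = (y - x) /\<^sub>R h"
  have yw: "y = x + h *\<^sub>R w" using h by (simp add: w_def)
  have Fy: "F y = u (t + h, y) - h * L w" using h by (simp add: F_def yw L_scale power2_eq_square)
  have "norm w \<le> M"
  proof (rule speed)
    have "F x \<le> F y" using y Mh by simp
    then have "h * L w \<le> u (t + h, y) - u (t + h, x)" using Fy by (simp add: F_def L_zero)
    also have "\<dots> \<le> \<Lambda> * dist (t + h, y) (t + h, x)"
    proof -
      have "(t + h, y) \<in> {0<..} \<times> ball c \<rho>" "(t + h, x) \<in> {0<..} \<times> ball c \<rho>"
        using reg[OF y(1)] reg[of x] Mh a region_ball[OF reg[OF y(1)]] region_ball[OF tx] by (auto simp: region_def)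
      then have "dist (u (t + h, y)) (u (t + h, x)) \<le> \<Lambda> * dist (t + h, y) (t + h, x)"
        by (rule lipschitz_onD[OF lip])
      then show ?thesis unfolding dist_real_def by linarith
    qed
    also have "dist (t + h, y) (t + h, x) = h * norm w" using h by (simp add: dist_Pair_Pair yw dist_norm)
    finally have "h * L w \<le> h * (\<Lambda> * norm w)" by (simp add: algebra_simps)
    then show "L w \<le> \<Lambda> * norm w" using h by simp
  qed
  then have yx: "norm (y - x) \<le> M * h" using h by (simp add: yw mult.commute[of M])
  have ty: "(t + h, x + h *\<^sub>R w) \<in> region" using reg[OF y(1)] yw by simp
  have "\<forall>\<^sub>F z in nhds y. z \<in> ball x (2 * M * h)"
    using yx Mh by (intro eventually_nhds_in_open) (auto simp: dist_norm norm_minus_commute)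
  then have "\<forall>\<^sub>F z in nhds y. F z \<le> F y" by eventually_elim (use y(2) in auto)
  then have max: "\<forall>\<^sub>F z in nhds (x + h *\<^sub>R w). u (t + h, z) - L (z - x) / h \<le> u (t + h, x + h *\<^sub>R w) - h * L w"
    using Fy unfolding F_def yw by simp
  have "spread ((a - h) / (a + h) * S) (t + h, y)"
    unfolding spread_def
  proof
    fix z
    obtain v where v: "v \<in> min_velocities (t, x)" "S \<le> L (w - v)" using S unfolding spread_def by blast
    obtain v' where v': "v' \<in> min_velocities (t + h, y)" "B v' (z - w) \<le> B w (z - w)"
      using maximizer_velocity[OF ty h(1) max, of "z - w"] unfolding yw by blast
    have "(a - h) / (a + h) * S \<le> (a - h) / (a + h) * L (w - v)"
      using v(2) h a by (intro mult_left_mono) auto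
    also have "\<dots> \<le> L (w - v')" using defect_comparison[OF tx ty h v(1)] v'(1) yw by simp
    also have "\<dots> \<le> L ((z - w) + (w - v'))"
      using L_add[of "z - w" "w - v'"] B_sym[of "z - w" "w - v'"] B_diff_left[of w v' "z - w"]
        v'(2) L_nonneg[of "z - w"] by linarith
    finally show "\<exists>v\<in>min_velocities (t + h, y). (a - h) / (a + h) * S \<le> L (z - v)"
      using v'(1) by auto
  qed
  then show ?thesis using yx by blast
qed

text \<open>The radius \<open>2 M T < r\<close> leaves room for the balls of radius \<open>2 M h\<close> in which the steps are chosen. Bernoulli's inequality
bounds the loss of spread independently of the number of steps.\<close>
lemma spread_chain:
  fixes n :: nat
  assumes t: "\<alpha> < t" and S: "spread S (t, c)" "0 \<le> S" and T: "0 < T" "T \<le> a / 4" "2 * M * T < r" and n: "0 < n"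
  shows "\<exists>X. X 0 = c \<and> (\<forall>k<n. norm (X (Suc k) - X k) \<le> M * (T / n)) \<and>
    (\<forall>k\<le>n. norm (X k - c) \<le> M * T \<and> spread (S / 2) (t + k * (T / n), X k))"
proof -
  define h where "h = T / n"
  have "1 \<le> real n" using n by simp
  then have h: "0 < h" "h * n = T" "h \<le> T"
    using T n by (auto simp: h_def divide_le_eq mult_le_cancel_left1)
  define q where "q = (a - h) / (a + h)"
  have ha: "h < a" using h T a by linarith
  have step: "\<exists>y. (Suc k \<le> n \<longrightarrow> norm (y - c) \<le> M * (Suc k * h) \<and> spread (q ^ Suc k * S) (t + Suc k * h, y)) \<and>
      (k < n \<longrightarrow> norm (y - x) \<le> M * h)"
    if x: "k \<le> n \<longrightarrow> norm (x - c) \<le> M * (k * h) \<and> spread (q ^ k * S) (t + k * h, x)" for k x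
  proof (cases "k < n")
    case True
    then have x': "norm (x - c) \<le> M * (k * h)" "spread (q ^ k * S) (t + k * h, x)" using x by auto
    have "(k + 1) * h \<le> n * h" using True h by (intro mult_right_mono) auto
    then have kh: "k * h + h \<le> T" using h by (simp add: algebra_simps)
    have "M * (k * h) + 2 * M * h \<le> 2 * M * T"
    proof -
      have "M * (k * h + 2 * h) \<le> M * (2 * T)" using kh h M by (intro mult_left_mono) auto
      then show ?thesis by (simp add: algebra_simps)
    qed
    then have sum: "norm (x - c) + 2 * M * h < r" using x'(1) T(3) by linarith
    have room: "cball x (2 * M * h) \<subseteq> ball c r"
    proof
      fix z assume "z \<in> cball x (2 * M * h)"
      then show "z \<in> ball c r"
        using sum dist_triangle[of c z x] by (simp add: dist_norm norm_minus_commute)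
    qed
    have "0 \<le> k * h" using h by simp
    moreover have "x \<in> ball c r" using room h M by (auto simp: subset_iff)
    ultimately have "(t + k * h, x) \<in> region" using t by (simp add: region_def)
    moreover have "0 \<le> q ^ k * S" using S(2) ha h by (simp add: q_def)
    ultimately obtain y where y: "norm (y - x) \<le> M * h" "spread (q * (q ^ k * S)) (t + k * h + h, y)"
      using spread_step[of "t + k * h" x h "q ^ k * S"] h ha x'(2) room unfolding q_def by blast
    have "norm (y - c) \<le> norm (y - x) + norm (x - c)" using norm_triangle_ineq[of "y - x" "x - c"] by simp
    then have "norm (y - c) \<le> M * (Suc k * h)" using y(1) x'(1) by (simp add: algebra_simps)
    then show ?thesis using y by (intro exI[of _ y]) (auto simp: algebra_simps)
  qed auto
  have "\<exists>X. \<forall>k. (k \<le> n \<longrightarrow> norm (X k - c) \<le> M * (k * h) \<and> spread (q ^ k * S) (t + k * h, X k)) \<and>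
      (k < n \<longrightarrow> norm (X (Suc k) - X k) \<le> M * h)"
    by (rule dependent_nat_choice) (use S step in auto)
  then obtain X where X: "\<And>k. k \<le> n \<Longrightarrow> norm (X k - c) \<le> M * (k * h)"
    "\<And>k. k \<le> n \<Longrightarrow> spread (q ^ k * S) (t + k * h, X k)"
    "\<And>k. k < n \<Longrightarrow> norm (X (Suc k) - X k) \<le> M * h"
    by metis
  have kh: "k * h \<le> T" if "k \<le> n" for k
    using mult_right_mono[of "real k" "real n" h] that h by (simp add: mult.commute)
  have "X 0 = c" using X(1)[of 0] by simp
  moreover have "norm (X k - c) \<le> M * T" if "k \<le> n" for k
    using X(1)[OF that] mult_left_mono[OF kh[OF that], of M] M by linarith
  moreover have "spread (S / 2) (t + k * h, X k)" if "k \<le> n" for k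
  proof (rule spread_mono[OF X(2)[OF that]])
    have "1 - 2 * h / a \<le> q"
      using a h ha by (simp add: q_def field_simps)
    moreover have "2 * h / a \<le> 1 / 2" using a h T by (simp add: field_simps)
    ultimately have "(1 - 2 * h / a) ^ k \<le> q ^ k" by (intro power_mono) auto
    moreover have "1 + real k * (- (2 * h / a)) \<le> (1 + - (2 * h / a)) ^ k"
      using \<open>2 * h / a \<le> 1 / 2\<close> by (intro Bernoulli_inequality) auto
    moreover have "real k * (2 * h / a) \<le> 1 / 2"
      using kh[OF that] T(2) a by (simp add: field_simps)
    ultimately have "1 / 2 \<le> q ^ k" by simp
    then show "S / 2 \<le> q ^ k * S" using mult_right_mono[of "1 / 2" "q ^ k" S] S(2) by simp
  qed
  ultimately show ?thesis using X(3) unfolding h_def by blast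
qed

lemma singular_arc:
  assumes t: "\<alpha> < t" and S: "spread S (t, c)" "0 < S" and T: "0 < T" "T \<le> a / 4" "2 * M * T < r"
  shows "\<exists>\<gamma>. M-lipschitz_on {t..t + T} \<gamma> \<and> \<gamma> t = c \<and>
    (\<forall>s\<in>{t..t + T}. \<gamma> s \<in> ball c r \<and> \<not> u differentiable (at (s, \<gamma> s)))"
proof -
  define h where "h n = T / real (Suc n)" for n
  have h0: "0 < h n" for n using T by (simp add: h_def)
  have "\<exists>X. X 0 = c \<and> (\<forall>k<Suc n. norm (X (Suc k) - X k) \<le> M * h n) \<and>
    (\<forall>k\<le>Suc n. norm (X k - c) \<le> M * T \<and> spread (S / 2) (t + k * h n, X k))" for n
    unfolding h_def by (rule spread_chain[OF t S(1) less_imp_le[OF S(2)] T zero_less_Suc])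
  then obtain X where X0: "\<And>n. X n 0 = c" and Xstep: "\<And>n k. k < Suc n \<Longrightarrow> norm (X n (Suc k) - X n k) \<le> M * h n"
    and XT: "\<And>n k. k \<le> Suc n \<Longrightarrow> norm (X n k - c) \<le> M * T"
    and XS: "\<And>n k. k \<le> Suc n \<Longrightarrow> spread (S / 2) (t + k * h n, X n k)"
    by metis
  \<comment> \<open>The trajectories are extended to all times as step functions, whose jumps have size at most \<open>M * h n\<close>.\<close>
  define K where "K n s = nat \<lfloor>s / h n\<rfloor>" for n s
  define f where "f n s = X n (K n s)" for n s
  have K: "K n s \<le> Suc n" "real (K n s) * h n \<le> s" "s < real (K n s) * h n + h n" if s: "s \<in> {0..T}" for n s
  proof -
    have "s / h n \<le> Suc n" using mult_right_mono[of s T "real (Suc n)"] s T by (simp add: h_def field_simps)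
    then show "K n s \<le> Suc n" unfolding K_def by (simp add: nat_le_iff floor_le_iff)
    have fl: "real (K n s) = \<lfloor>s / h n\<rfloor>" using s h0[of n] by (simp add: K_def)
    show "real (K n s) * h n \<le> s"
      unfolding fl pos_le_divide_eq[OF h0, symmetric] by (rule of_int_floor_le)
    have "s / h n < \<lfloor>s / h n\<rfloor> + 1" by linarith
    then have "s < (\<lfloor>s / h n\<rfloor> + 1) * h n" unfolding pos_divide_less_eq[OF h0] .
    then show "s < real (K n s) * h n + h n" unfolding fl by (simp add: algebra_simps)
  qed
  have Xdiff: "norm (X n j - X n i) \<le> M * (real (j - i) * h n)" if "i \<le> j" "j \<le> Suc n" for n i j
    using that
  proof (induction j rule: dec_induct)
    case (step j)
    have "norm (X n (Suc j) - X n i) \<le> norm (X n (Suc j) - X n j) + norm (X n j - X n i)"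
      using norm_triangle_ineq[of "X n (Suc j) - X n j" "X n j - X n i"] by simp
    also have "\<dots> \<le> M * h n + M * (real (j - i) * h n)"
      using step Xstep[of j n] by (intro add_mono) auto
    also have "\<dots> = M * (real (Suc j - i) * h n)"
      using step by (simp add: Suc_diff_le algebra_simps)
    finally show ?case .
  qed simp
  have almost': "norm (f n s - f n s') \<le> M * (\<bar>s - s'\<bar> + h n)" if "s' \<in> {0..T}" "s \<in> {0..T}" "s' \<le> s" for n s s'
  proof -
    have "s' / h n \<le> s / h n" using that h0[of n] by (simp add: divide_right_mono)
    then have le: "K n s' \<le> K n s" unfolding K_def by (intro nat_mono floor_mono)
    have "real (K n s - K n s') * h n \<le> \<bar>s - s'\<bar> + h n"
      using le K[OF that(1), of n] K[OF that(2), of n] that(3) by (simp add: of_nat_diff algebra_simps)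
    then have "M * (real (K n s - K n s') * h n) \<le> M * (\<bar>s - s'\<bar> + h n)" using M by simp
    then show ?thesis using Xdiff[OF le K(1)[OF that(2)]] unfolding f_def by linarith
  qed
  have almost: "norm (f n s - f n s') \<le> M * (\<bar>s - s'\<bar> + h n)" if "s \<in> {0..T}" "s' \<in> {0..T}" for n s s'
  proof (cases "s' \<le> s")
    case False
    then show ?thesis using almost'[of s s' n] that by (simp add: norm_minus_commute abs_minus_commute)
  qed (use almost' that in blast)
  have bounded: "norm (f n s) \<le> norm c + M * T" if "s \<in> {0..T}" for n s
    using XT[OF K(1)[OF that]] norm_triangle_ineq2[of "f n s" c] unfolding f_def by (smt (verit))
  have h_lim: "h \<longlonglongrightarrow> 0"
    unfolding h_def using tendsto_mult[OF tendsto_const LIMSEQ_inverse_real_of_nat, of T]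
    by (simp add: divide_inverse)
  obtain k g where k: "strict_mono k" and g: "\<And>s. s \<in> {0..T} \<Longrightarrow> (\<lambda>n. f (k n) s) \<longlonglongrightarrow> g s"
    and gM: "M-lipschitz_on {0..T} g"
    using almost_lipschitz_subsequence[OF T(1) bounded almost h_lim M] by blast
  have hk: "(\<lambda>n. h (k n)) \<longlonglongrightarrow> 0" using LIMSEQ_subseq_LIMSEQ[OF h_lim k] by (simp add: o_def)
  have "0 < M * T" using T M by simp
  then have MT: "M * T < r" using T(3) by linarith
  have fball: "f n s \<in> cball c (M * T)" if "s \<in> {0..T}" for n s
    using XT[OF K(1)[OF that]] by (simp add: f_def dist_norm norm_minus_commute)
  have gball: "g s \<in> cball c (M * T)" if "s \<in> {0..T}" for s
    by (rule closed_sequentially[OF closed_cball fball[OF that] g[OF that]])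
  have sing: "\<not> u differentiable (at (t + s, g s))" if s: "s \<in> {0..T}" for s
  proof -
    define P where "P n = (t + real (K (k n) s) * h (k n), f (k n) s)" for n
    have "(\<lambda>n. real (K (k n) s) * h (k n)) \<longlonglongrightarrow> s"
    proof (rule tendsto_sandwich)
      show "(\<lambda>n. s - h (k n)) \<longlonglongrightarrow> s" using tendsto_diff[OF tendsto_const hk, of s] by simp
      show "\<forall>\<^sub>F n in sequentially. s - h (k n) \<le> real (K (k n) s) * h (k n)"
        using K(3)[OF s] by (intro always_eventually allI) (smt (verit))
      show "\<forall>\<^sub>F n in sequentially. real (K (k n) s) * h (k n) \<le> s"
        using K(2)[OF s] by (intro always_eventually allI)
    qed simp
    then have "P \<longlonglongrightarrow> (t + s, g s)" unfolding P_def by (intro tendsto_intros g s)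
    moreover have "P n \<in> region" for n
    proof -
      have "0 \<le> real (K (k n) s) * h (k n)" using h0[of "k n"] by simp
      then show ?thesis using fball[OF s, of "k n"] t MT by (auto simp: P_def region_def)
    qed
    moreover have reg: "(t + s, g s) \<in> region" using gball[OF s] s t MT by (auto simp: region_def)
    moreover have "spread (S / 2) (P n)" for n
      unfolding P_def f_def by (rule XS[OF K(1)[OF s]])
    ultimately have "spread (S / 2) (t + s, g s)" by (rule spread_limit)
    then show ?thesis using spread_imp_not_differentiable[OF reg] S(2) by simp
  qed
  have g0: "g 0 = c"
  proof -
    have "f n 0 = c" for n by (simp add: f_def K_def X0)
    then show ?thesis using g[of 0] T by (simp add: LIMSEQ_const_iff)
  qed
  have "M-lipschitz_on {t..t + T} (\<lambda>s. g (s - t))"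
  proof (rule lipschitz_onI)
    fix s s' assume "s \<in> {t..t + T}" "s' \<in> {t..t + T}"
    then show "dist (g (s - t)) (g (s' - t)) \<le> M * dist s s'"
      using lipschitz_onD[OF gM, of "s - t" "s' - t"] by (simp add: dist_real_def)
  qed (use M in simp)
  moreover have "g (s - t) \<in> ball c r \<and> \<not> u differentiable (at (s, g (s - t)))" if "s \<in> {t..t + T}" for s
    using sing[of "s - t"] gball[of "s - t"] MT that by auto
  ultimately show ?thesis using g0 by (intro exI[of _ "\<lambda>s. g (s - t)"]) auto
qed

end

section \<open>Singular arcs of uniform length\<close>

context quadratic_hamiltonian begin

text \<open>For a given solution the Lipschitz constant is common to all arcs, and the length \<open>T\<close> depends only on a lower bound \<open>t0\<close> for the time and on
the radius \<open>R\<close> of a ball contained in the domain.\<close>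
lemma uniform_singular_arcs:
  fixes u :: "real \<times> (real^'n) \<Rightarrow> real"
  assumes "open \<Omega>" and sub: "viscosity_subsolution H (space_time \<Omega>) u"
    and super: "viscosity_supersolution H (space_time \<Omega>) u"
    and lip: "\<Lambda>-lipschitz_on (space_time \<Omega>) u"
  obtains M where "0 < M"
    "\<And>t0 R. 0 < t0 \<Longrightarrow> 0 < R \<Longrightarrow> \<exists>T>0. \<forall>t\<ge>t0. \<forall>x. cball x R \<subseteq> \<Omega> \<longrightarrow> (t, x) \<in> singular_set (space_time \<Omega>) u \<longrightarrow>
      (\<exists>\<gamma>. M-lipschitz_on {t..t + T} \<gamma> \<and> \<gamma> t = x \<and> (\<forall>s\<in>{t..t + T}. (s, \<gamma> s) \<in> singular_set (space_time \<Omega>) u))"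
proof -
  have openQ: "open (space_time \<Omega>)" unfolding space_time_def using \<open>open \<Omega>\<close> by (intro open_Times) auto
  have \<Lambda>: "0 \<le> \<Lambda>" using lip by (rule lipschitz_on_nonneg)
  obtain c where c: "0 < c" "\<And>v. c * (norm v)\<^sup>2 \<le> L v" using L_coercive by blast
  obtain k where k: "0 < k" "\<And>p. norm (A *v p) \<le> k * norm p"
    using bounded_linear.pos_bounded[OF matrix_vector_mul_bounded_linear[of A]] by (metis mult.commute)
  define M where "M = 1 + 2 * \<Lambda> / c"
  have M: "1 \<le> M" "0 < M" using c \<Lambda> by (auto simp: M_def add_pos_nonneg)
  have speed': "norm v \<le> M" if "L v \<le> \<Lambda> * (1 + norm v)" for v
  proof (rule ccontr)
    assume "\<not> norm v \<le> M"
    then have v: "1 < norm v" "2 * \<Lambda> / c < norm v" using M by (auto simp: M_def)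
    have "c * (norm v)\<^sup>2 \<le> \<Lambda> * (1 + norm v)" using c(2)[of v] that by linarith
    also have "\<dots> \<le> \<Lambda> * (2 * norm v)" using v \<Lambda> by (intro mult_left_mono) auto
    finally have "norm v * (c * norm v) \<le> norm v * (2 * \<Lambda>)" by (simp add: power2_eq_square algebra_simps)
    then have "c * norm v \<le> 2 * \<Lambda>" by (rule mult_left_le_imp_le) (use v(1) in linarith)
    then show False using v(2) c(1) by (simp add: pos_divide_less_eq mult.commute)
  qed
  have arcs: "\<exists>T>0. \<forall>t\<ge>t0. \<forall>x. cball x R \<subseteq> \<Omega> \<longrightarrow> (t, x) \<in> singular_set (space_time \<Omega>) u \<longrightarrow>
      (\<exists>\<gamma>. M-lipschitz_on {t..t + T} \<gamma> \<and> \<gamma> t = x \<and> (\<forall>s\<in>{t..t + T}. (s, \<gamma> s) \<in> singular_set (space_time \<Omega>) u))"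
    if t0: "0 < t0" and R: "0 < R" for t0 R
  proof -
    \<comment> \<open>A third of \<open>R\<close> each for the arc, for the length of the minimizing motions, and as a margin.\<close>
    define r where "r = R / 3"
    have r: "0 < r" "R = 3 * r" using R by (auto simp: r_def)
    then have rR: "r < R" by simp
    define C where "C = 2 * r * k * \<Lambda> + 1"
    have C: "0 < C" "2 * r * k * \<Lambda> < C" using r k \<Lambda> by (auto simp: C_def add_nonneg_pos)
    define a where "a = min (t0 / 2) (min (r\<^sup>2 / (2 * C)) (r / M))"
    have "0 < a" using t0 r C M by (simp add: a_def)
    moreover have "a \<le> t0 / 2" "a \<le> r\<^sup>2 / (2 * C)" "a \<le> r / M" unfolding a_def by linarith+
    ultimately have a: "0 < a" "a \<le> t0 / 2" "a \<le> r\<^sup>2 / (2 * C)" "a \<le> r / M" by blast+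
    have aM: "a * M \<le> r" using a(4) M by (simp add: pos_le_divide_eq)
    have aC: "C * a \<le> r\<^sup>2 / 2" using a(3) C by (simp add: field_simps)
    define T where "T = min (a / 4) (r / (4 * M))"
    have T: "0 < T" using a r M by (simp add: T_def)
    have "T \<le> a / 4" "T \<le> r / (4 * M)" unfolding T_def by linarith+
    note T = T this(1) and T_le = this(2)
    have "2 * M * T \<le> r / 2" using T_le M by (simp add: field_simps)
    then have MT: "2 * M * T < r" using r by linarith
    have "\<exists>\<gamma>. M-lipschitz_on {t..t + T} \<gamma> \<and> \<gamma> t = x \<and> (\<forall>s\<in>{t..t + T}. (s, \<gamma> s) \<in> singular_set (space_time \<Omega>) u)"
      if t: "t0 \<le> t" and x: "cball x R \<subseteq> \<Omega>" and sing: "(t, x) \<in> singular_set (space_time \<Omega>) u" for t x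
    proof -
      have Q: "{0<..} \<times> ball x R \<subseteq> space_time \<Omega>" using x by (auto simp: space_time_def)
      have below: "u (t, y) \<le> u (s, z) + L (y - z) / (t - s)"
        if "0 < s" "s < t" "y \<in> ball x R" "z \<in> ball x R" for s t y z
      proof (rule subsolution_along_segments[OF sub lip openQ \<open>s < t\<close>])
        have "closed_segment (s, z) (t, y) \<subseteq> {0<..} \<times> ball x R"
          using that by (intro closed_segment_subset convex_Times) auto
        then show "closed_segment (s, z) (t, y) \<subseteq> space_time \<Omega>" using Q by blast
      qed
      interpret hopf_lax_region A u x R r a "t0 / 2" M \<Lambda>
      proof unfold_locales
        show "0 < a" "a \<le> t0 / 2" "0 < M" "0 < r" by fact+
        show "r + a * M < R" using aM r by linarith
        show "\<Lambda>-lipschitz_on ({0<..} \<times> ball x R) u" using lip Q by (rule lipschitz_on_subset)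
        show "u (t, y) \<le> u (s, z) + L (y - z) / (t - s)"
          if "0 < s" "s < t" "y \<in> ball x R" "z \<in> ball x R" for s t y z by (rule below[OF that])
        show "norm v \<le> M" if "L v \<le> \<Lambda> * norm v" for v
          using that \<Lambda> by (intro speed') (simp add: algebra_simps)
        show "\<exists>v. norm v \<le> M \<and> u (t, y) = u (t - a, y - a *\<^sub>R v) + a * L v"
          if t: "t0 / 2 < t" and y: "y \<in> ball x r" for t y
        proof -
          have yr: "cball y r \<subseteq> ball x R"
          proof
            fix z assume "z \<in> cball y r"
            then show "z \<in> ball x R" using y r dist_triangle[of x z y] by (simp add: dist_commute)
          qed
          have s: "0 < t - a" "t - a < t" using a t by auto
          have cone: "C * (t - (t - a)) \<le> r\<^sup>2 / 2" using aC by simp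
          have cyl: "{t - a..t + r\<^sup>2 / (2 * C)} \<times> cball y r \<subseteq> space_time \<Omega>"
            using yr s Q by fastforce
          obtain z where z: "z \<in> cball y r" "u (t - a, z) + L (y - z) / a \<le> u (t, y)"
            using supersolution_hopf_lax_bound[OF super lip openQ s(2) r(1) k(2) less_imp_le[OF k(1)] C(2) cone cyl]
            by auto
          define v where "v = (y - z) /\<^sub>R a"
          have zv: "z = y - a *\<^sub>R v" "L (y - z) / a = a * L v"
          proof -
            show z: "z = y - a *\<^sub>R v" using a by (simp add: v_def)
            show "L (y - z) / a = a * L v" using a by (simp add: z L_scale power2_eq_square)
          qed
          have yz: "y \<in> ball x R" "z \<in> ball x R" using y r subsetD[OF yr z(1)] by auto
          have eq: "u (t, y) = u (t - a, z) + a * L v"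
            using below[OF s yz] z(2) zv(2) by simp
          have "a * L v \<le> \<Lambda> * dist (t, y) (t - a, z)"
          proof -
            have "dist (u (t, y)) (u (t - a, z)) \<le> \<Lambda> * dist (t, y) (t - a, z)"
              using Q s yz by (intro lipschitz_onD[OF lip]) auto
            then show ?thesis using eq unfolding dist_real_def by linarith
          qed
          also have "dist (t, y) (t - a, z) \<le> a + a * norm v"
            using norm_Pair_le[of a "a *\<^sub>R v"] a by (simp add: dist_norm zv(1))
          then have "\<Lambda> * dist (t, y) (t - a, z) \<le> \<Lambda> * (a + a * norm v)" using \<Lambda> by (rule mult_left_mono)
          also have "\<dots> = a * (\<Lambda> * (1 + norm v))" by (simp add: algebra_simps)
          finally have "L v \<le> \<Lambda> * (1 + norm v)" using a by simp
          then show ?thesis using speed' eq zv(1) by blast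
        qed
      qed
      have tx: "(t, x) \<in> region" using t t0 r by (simp add: region_def)
      obtain S where S: "0 < S" "spread S (t, x)"
        using not_differentiable_imp_spread[OF tx] sing by (auto simp: singular_set_def)
      have "t0 / 2 < t" using t t0 by simp
      then obtain \<gamma> where \<gamma>: "M-lipschitz_on {t..t + T} \<gamma>" "\<gamma> t = x"
        "\<And>s. s \<in> {t..t + T} \<Longrightarrow> \<gamma> s \<in> ball x r \<and> \<not> u differentiable (at (s, \<gamma> s))"
        using singular_arc[OF _ S(2,1) T MT] by blast
      have "(s, \<gamma> s) \<in> singular_set (space_time \<Omega>) u" if "s \<in> {t..t + T}" for s
      proof -
        have "(s, \<gamma> s) \<in> {0<..} \<times> ball x R" using \<gamma>(3)[OF that] that t t0 rR by auto
        then show ?thesis using \<gamma>(3)[OF that] Q by (auto simp: singular_set_def)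
      qed
      then show ?thesis using \<gamma>(1,2) by blast
    qed
    then show ?thesis using T(1) by blast
  qed
  show ?thesis using that[OF M(2) arcs] by blast
qed

end

section \<open>Continuation up to the boundary\<close>

text \<open>Arcs are extended step by step, each time by at least half of what is possible with an increment of at most one. If
the endpoints converged at a finite time to a point inside \<open>\<Omega>\<close>, the arcs provided near that point would give
extensions by a fixed length, against the convergence of the increments to zero.\<close>
lemma maximal_lipschitz_arc:
  fixes \<Omega> :: "'v::euclidean_space set" and \<Sigma> :: "(real \<times> 'v) set"
  assumes "open \<Omega>" and \<Sigma>: "\<And>t x. (t, x) \<in> \<Sigma> \<Longrightarrow> x \<in> \<Omega>" and start: "(t0, x0) \<in> \<Sigma>" and M: "0 < M"
    and arcs: "\<And>R. 0 < R \<Longrightarrow> \<exists>T>0. \<forall>t\<ge>t0. \<forall>x. cball x R \<subseteq> \<Omega> \<longrightarrow> (t, x) \<in> \<Sigma> \<longrightarrow>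
      (\<exists>\<gamma>. M-lipschitz_on {t..t + T} \<gamma> \<and> \<gamma> t = x \<and> (\<forall>s\<in>{t..t + T}. (s, \<gamma> s) \<in> \<Sigma>))"
  shows "\<exists>(T::ereal) \<gamma>. 0 < T
    \<and> lipschitz_cont_on {s. t0 \<le> s \<and> ereal s < ereal t0 + T} \<gamma>
    \<and> \<gamma> t0 = x0
    \<and> (\<forall>s. t0 \<le> s \<and> ereal s < ereal t0 + T \<longrightarrow> (s, \<gamma> s) \<in> \<Sigma>)
    \<and> (T < \<infinity> \<longrightarrow> (\<exists>l \<in> frontier \<Omega>. (\<gamma> \<longlongrightarrow> l) (at_left (t0 + real_of_ereal T))))"
proof -
  define G where "G b \<gamma> \<longleftrightarrow> t0 \<le> b \<and> M-lipschitz_on {t0..b} \<gamma> \<and> \<gamma> t0 = x0 \<and> (\<forall>s\<in>{t0..b}. (s, \<gamma> s) \<in> \<Sigma>)" for b \<gamma>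
  \<comment> \<open>The increment is capped at one, so that the supremum of the possible end times is finite.\<close>
  define E where "E b \<gamma> = {b'. b < b' \<and> b' \<le> b + 1 \<and> (\<exists>\<gamma>'. G b' \<gamma>' \<and> (\<forall>s\<in>{t0..b}. \<gamma>' s = \<gamma> s))}" for b \<gamma>
  have extend: "\<exists>T>0. \<forall>b \<gamma>. G b \<gamma> \<longrightarrow> cball (\<gamma> b) R \<subseteq> \<Omega> \<longrightarrow> b + T \<in> E b \<gamma>" if "0 < R" for R
  proof -
    obtain T where T: "0 < T" "\<And>t x. t0 \<le> t \<Longrightarrow> cball x R \<subseteq> \<Omega> \<Longrightarrow> (t, x) \<in> \<Sigma> \<Longrightarrow>
      \<exists>\<gamma>. M-lipschitz_on {t..t + T} \<gamma> \<and> \<gamma> t = x \<and> (\<forall>s\<in>{t..t + T}. (s, \<gamma> s) \<in> \<Sigma>)"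
      using arcs[OF \<open>0 < R\<close>] by metis
    define T' where "T' = min T 1"
    have T': "0 < T'" "T' \<le> 1" "T' \<le> T" using T by (auto simp: T'_def)
    have "b + T' \<in> E b \<gamma>" if G: "G b \<gamma>" and R: "cball (\<gamma> b) R \<subseteq> \<Omega>" for b \<gamma>
    proof -
      obtain \<delta> where \<delta>: "M-lipschitz_on {b..b + T} \<delta>" "\<delta> b = \<gamma> b" "\<And>s. s \<in> {b..b + T} \<Longrightarrow> (s, \<delta> s) \<in> \<Sigma>"
        using T(2)[of b "\<gamma> b"] G R unfolding G_def by auto
      define \<gamma>' where "\<gamma>' s = (if s \<le> b then \<gamma> s else \<delta> s)" for s
      have "M-lipschitz_on {t0..b + T'} \<gamma>'"
        unfolding \<gamma>'_def
      proof (rule lipschitz_on_concat)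
        show "M-lipschitz_on {t0..b} \<gamma>" using G by (simp add: G_def)
        show "M-lipschitz_on {b..b + T'} \<delta>" by (rule lipschitz_on_subset[OF \<delta>(1)]) (use T' in auto)
      qed (use \<delta>(2) in simp)
      moreover have "(s, \<gamma>' s) \<in> \<Sigma>" if "s \<in> {t0..b + T'}" for s
        using that G \<delta>(3)[of s] T' by (auto simp: \<gamma>'_def G_def)
      ultimately have "G (b + T') \<gamma>'" using G T' by (auto simp: G_def \<gamma>'_def)
      then show ?thesis using T' unfolding E_def by (auto simp: \<gamma>'_def intro!: exI[of _ \<gamma>'])
    qed
    then show ?thesis using T'(1) by blast
  qed
  have next_arc: "\<exists>b' \<gamma>'. G b' \<gamma>' \<and> b < b' \<and> (\<forall>s\<in>{t0..b}. \<gamma>' s = \<gamma> s) \<and> (\<forall>b''\<in>E b \<gamma>. b'' - b \<le> 2 * (b' - b))"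
    if G: "G b \<gamma>" for b \<gamma>
  proof -
    have "\<gamma> b \<in> \<Omega>" using G \<Sigma>[of b "\<gamma> b"] by (auto simp: G_def)
    then obtain R where "0 < R" "cball (\<gamma> b) R \<subseteq> \<Omega>" using \<open>open \<Omega>\<close> open_contains_cball by blast
    then obtain b1 where b1: "b1 \<in> E b \<gamma>" using extend[of R] G by blast
    have bdd: "bdd_above (E b \<gamma>)" by (rule bdd_aboveI[of _ "b + 1"]) (auto simp: E_def)
    have "b < Sup (E b \<gamma>)" using cSup_upper[OF b1 bdd] b1 by (auto simp: E_def)
    then have "b + (Sup (E b \<gamma>) - b) / 2 < Sup (E b \<gamma>)" by (simp add: field_simps)
    then obtain b' where b': "b' \<in> E b \<gamma>" "b + (Sup (E b \<gamma>) - b) / 2 < b'"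
      using less_cSupE b1 by (metis empty_iff)
    have "b'' - b \<le> 2 * (b' - b)" if "b'' \<in> E b \<gamma>" for b''
      using cSup_upper[OF that bdd] b'(2) by (simp add: field_simps)
    then show ?thesis using b'(1) unfolding E_def by blast
  qed
  have "G t0 (\<lambda>_. x0)" using start M by (auto simp: G_def lipschitz_on_def)
  then have "\<exists>f. \<forall>n. G (fst (f n)) (snd (f n)) \<and> (fst (f n) < fst (f (Suc n)) \<and>
      (\<forall>s\<in>{t0..fst (f n)}. snd (f (Suc n)) s = snd (f n) s) \<and>
      (\<forall>b''\<in>E (fst (f n)) (snd (f n)). b'' - fst (f n) \<le> 2 * (fst (f (Suc n)) - fst (f n))))"
    using next_arc by (intro dependent_nat_choice[where P = "\<lambda>n p. G (fst p) (snd p)"]) auto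
  then obtain f where f: "\<And>n. G (fst (f n)) (snd (f n))" "\<And>n. fst (f n) < fst (f (Suc n))"
      "\<And>n s. s \<in> {t0..fst (f n)} \<Longrightarrow> snd (f (Suc n)) s = snd (f n) s"
      "\<And>n b''. b'' \<in> E (fst (f n)) (snd (f n)) \<Longrightarrow> b'' - fst (f n) \<le> 2 * (fst (f (Suc n)) - fst (f n))"
    by metis
  define b where "b n = fst (f n)" for n
  define g where "g n = snd (f n)" for n
  have G: "G (b n) (g n)" for n using f(1) by (simp add: b_def g_def)
  have "strict_mono b" using f(2) by (simp add: strict_mono_Suc_iff b_def)
  then have mono: "m \<le> n \<Longrightarrow> b m \<le> b n" for m n by (simp add: strict_mono_less_eq)
  have t0b: "t0 \<le> b n" for n using G[of n] by (simp add: G_def)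
  have agree: "g n s = g m s" if "m \<le> n" "s \<in> {t0..b m}" for m n s
    using that(1)
  proof (induction n rule: dec_induct)
    case (step n)
    then show ?case using f(3)[of s n] that(2) mono[of m n] by (auto simp: b_def g_def)
  qed simp
  define \<gamma> where "\<gamma> s = g (LEAST n. s \<le> b n) s" for s
  have \<gamma>: "\<gamma> s = g n s" if "s \<in> {t0..b n}" for s n
  proof -
    have "(LEAST n. s \<le> b n) \<le> n" "s \<le> b (LEAST n. s \<le> b n)"
      using that by (auto intro: Least_le LeastI)
    then show ?thesis unfolding \<gamma>_def using agree[of "LEAST n. s \<le> b n" n s] that by auto
  qed
  have lip\<gamma>: "M-lipschitz_on {t0..b n} \<gamma>" for n
    using G[of n] \<gamma> unfolding G_def by (metis (no_types, lifting) lipschitz_on_transform)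
  have sing: "(s, \<gamma> s) \<in> \<Sigma>" if "s \<in> {t0..b n}" for s n
    using G[of n] \<gamma>[OF that] that by (auto simp: G_def)
  have \<gamma>0: "\<gamma> t0 = x0" using \<gamma>[of t0 0] t0b[of 0] G[of 0] by (auto simp: G_def)
  have lip_on: "M-lipschitz_on I \<gamma>" if I: "\<And>s. s \<in> I \<Longrightarrow> t0 \<le> s \<and> (\<exists>n. s \<le> b n)" for I
  proof (rule lipschitz_onI)
    fix s s' assume ss: "s \<in> I" "s' \<in> I"
    then obtain m n where mn: "s \<le> b m" "s' \<le> b n" "t0 \<le> s" "t0 \<le> s'" using I by meson
    then have "s \<in> {t0..b (max m n)}" "s' \<in> {t0..b (max m n)}"
      using mono[of m "max m n"] mono[of n "max m n"] by auto
    then show "dist (\<gamma> s) (\<gamma> s') \<le> M * dist s s'" by (rule lipschitz_onD[OF lip\<gamma>])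
  qed (use M in simp)
  show ?thesis
  proof (cases "bdd_above (range b)")
    case False
    then have cofinal: "\<exists>n. s \<le> b n" for s unfolding bdd_above_def by (metis linear rangeE)
    have "lipschitz_cont_on {s. t0 \<le> s \<and> ereal s < ereal t0 + \<infinity>} \<gamma>"
      unfolding lipschitz_cont_on_def by (rule exI[of _ M], rule lip_on) (use cofinal in simp)
    moreover have "(s, \<gamma> s) \<in> \<Sigma>" if "t0 \<le> s" for s using cofinal[of s] sing that by auto
    ultimately show ?thesis using \<gamma>0 by (intro exI[of _ "\<infinity>::ereal"] exI[of _ \<gamma>]) auto
  next
    case True
    define \<beta> where "\<beta> = (SUP n. b n)"
    have "b \<longlonglongrightarrow> \<beta>"
      unfolding \<beta>_def using mono by (intro LIMSEQ_incseq_SUP True) (auto simp: incseq_def)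
    have b\<beta>: "b n < \<beta>" for n
    proof -
      have "b n < b (Suc n)" using f(2) by (simp add: b_def)
      also have "b (Suc n) \<le> \<beta>" unfolding \<beta>_def by (intro cSUP_upper True) auto
      finally show ?thesis .
    qed
    have cofinal: "\<exists>n. s \<le> b n" if "s < \<beta>" for s
      using order_tendstoD(1)[OF \<open>b \<longlonglongrightarrow> \<beta>\<close> that] by (auto simp: eventually_sequentially intro: less_imp_le)
    have t0\<beta>: "t0 < \<beta>" using t0b[of 0] b\<beta>[of 0] by simp
    have lip\<beta>: "M-lipschitz_on {t0..<\<beta>} \<gamma>" using cofinal by (intro lip_on) auto
    have "Cauchy (\<lambda>n. \<gamma> (b n))"
    proof (rule metric_CauchyI)
      fix e :: real assume "0 < e"
      then have "0 < e / M" using M by simp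
      then obtain N where N: "\<And>m n. N \<le> m \<Longrightarrow> N \<le> n \<Longrightarrow> dist (b m) (b n) < e / M"
        using LIMSEQ_imp_Cauchy[OF \<open>b \<longlonglongrightarrow> \<beta>\<close>] metric_CauchyD by blast
      have "dist (\<gamma> (b m)) (\<gamma> (b n)) < e" if "N \<le> m" "N \<le> n" for m n
      proof -
        have "dist (\<gamma> (b m)) (\<gamma> (b n)) \<le> M * dist (b m) (b n)"
          using t0b b\<beta> by (intro lipschitz_onD[OF lip\<beta>]) auto
        also have "\<dots> < e" using N[OF that] M by (simp add: field_simps)
        finally show ?thesis .
      qed
      then show "\<exists>N. \<forall>m\<ge>N. \<forall>n\<ge>N. dist (\<gamma> (b m)) (\<gamma> (b n)) < e" by blast
    qed
    then obtain l where l: "(\<lambda>n. \<gamma> (b n)) \<longlonglongrightarrow> l" using Cauchy_convergent_iff convergent_def by blast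
    have near: "dist (\<gamma> s) l \<le> M * (\<beta> - s)" if s: "s \<in> {t0..<\<beta>}" for s
    proof -
      have "(\<lambda>n. dist (\<gamma> s) (\<gamma> (b n))) \<longlonglongrightarrow> dist (\<gamma> s) l" by (intro tendsto_intros l)
      moreover have "(\<lambda>n. M * dist s (b n)) \<longlonglongrightarrow> M * dist s \<beta>" by (intro tendsto_intros \<open>b \<longlonglongrightarrow> \<beta>\<close>)
      moreover have "dist (\<gamma> s) (\<gamma> (b n)) \<le> M * dist s (b n)" for n
        using s t0b b\<beta> by (intro lipschitz_onD[OF lip\<beta>]) auto
      ultimately have "dist (\<gamma> s) l \<le> M * dist s \<beta>" by (auto intro: LIMSEQ_le)
      then show ?thesis using s by (simp add: dist_real_def)
    qed
    have lim: "(\<gamma> \<longlongrightarrow> l) (at_left \<beta>)"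
    proof -
      have "((\<lambda>s. dist (\<gamma> s) l) \<longlongrightarrow> 0) (at_left \<beta>)"
      proof (rule tendsto_sandwich[OF _ _ tendsto_const])
        show "\<forall>\<^sub>F s in at_left \<beta>. dist (\<gamma> s) l \<le> M * (\<beta> - s)"
          using eventually_at_left_real[OF t0\<beta>] by eventually_elim (use near in auto)
        show "((\<lambda>s. M * (\<beta> - s)) \<longlongrightarrow> 0) (at_left \<beta>)" by (auto intro!: tendsto_eq_intros)
      qed auto
      then show ?thesis by (rule iffD2[OF tendsto_dist_iff])
    qed
    have \<gamma>\<Omega>: "\<gamma> (b n) \<in> \<Omega>" for n using \<Sigma>[OF sing[of "b n" n]] t0b by simp
    have "l \<in> closure \<Omega>" 
      unfolding closure_sequential using \<gamma>\<Omega> l by (intro exI[of _ "\<lambda>n. \<gamma> (b n)"]) simp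
    moreover have "l \<notin> \<Omega>"
    proof
      assume "l \<in> \<Omega>"
      then obtain R where R: "0 < R" "cball l R \<subseteq> \<Omega>" using \<open>open \<Omega>\<close> open_contains_cball by blast
      obtain T where T: "0 < T" "\<And>b \<gamma>. G b \<gamma> \<Longrightarrow> cball (\<gamma> b) (R / 2) \<subseteq> \<Omega> \<Longrightarrow> b + T \<in> E b \<gamma>"
        using extend[of "R / 2"] R(1) by auto
      have "(\<lambda>n. b (Suc n) - b n) \<longlonglongrightarrow> \<beta> - \<beta>"
        using \<open>b \<longlonglongrightarrow> \<beta>\<close> by (intro tendsto_diff LIMSEQ_Suc)
      then have "\<forall>\<^sub>F n in sequentially. b (Suc n) - b n < T / 2" using T(1) by (intro order_tendstoD(2)) auto
      moreover have "\<forall>\<^sub>F n in sequentially. dist (\<gamma> (b n)) l < R / 2" using l R(1) by (intro tendstoD) auto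
      ultimately have "\<forall>\<^sub>F n in sequentially. b (Suc n) - b n < T / 2 \<and> dist (\<gamma> (b n)) l < R / 2"
        by eventually_elim auto
      then obtain n where n: "b (Suc n) - b n < T / 2" "dist (\<gamma> (b n)) l < R / 2"
        unfolding eventually_sequentially by blast
      have "cball (\<gamma> (b n)) (R / 2) \<subseteq> cball l R"
      proof
        fix z assume "z \<in> cball (\<gamma> (b n)) (R / 2)"
        then show "z \<in> cball l R"
          using n(2) dist_triangle[of l z "\<gamma> (b n)"] by (simp add: dist_commute)
      qed
      then have "cball (g n (b n)) (R / 2) \<subseteq> \<Omega>" using R(2) \<gamma>[of "b n" n] t0b[of n] by auto
      then have "b n + T \<in> E (b n) (g n)" by (rule T(2)[OF G])
      then show False using f(4)[of "b n + T" n] n(1) by (simp add: b_def g_def)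
    qed
    ultimately have "l \<in> frontier \<Omega>" using \<open>open \<Omega>\<close> by (simp add: frontier_def interior_open)
    moreover have I: "{s. t0 \<le> s \<and> ereal s < ereal t0 + ereal (\<beta> - t0)} = {t0..<\<beta>}" by auto
    moreover have "(s, \<gamma> s) \<in> \<Sigma>" if "s \<in> {t0..<\<beta>}" for s using cofinal[of s] sing[of s] that by auto
    ultimately show ?thesis
      using lip\<beta> \<gamma>0 lim t0\<beta>
      by (intro exI[of _ "ereal (\<beta> - t0)"] exI[of _ \<gamma>]) (auto simp: lipschitz_cont_on_def)
  qed
qed

theorem theorem4p2:
  fixes \<Omega> :: "(real^'n) set"
    and A :: "real^'n^'n"
    and \<phi> u :: "real \<times> (real^'n) \<Rightarrow> real"
    and t0 :: real and x0 :: "real^'n"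
  assumes "open \<Omega>"
    and "sym_pos_def A"
    and "lipschitz_cont_on (closure (space_time \<Omega>)) \<phi>"
    and "compatible (lagrangian A) (space_time \<Omega>) \<phi>"
    and "lipschitz_cont_on (closure (space_time \<Omega>)) u"
    and "viscosity_solution (hamiltonian A) (space_time \<Omega>) u"
    and "\<forall>z \<in> frontier (space_time \<Omega>). u z = \<phi> z"
    and "(t0, x0) \<in> singular_set (space_time \<Omega>) u"
  shows "\<exists>(T::ereal) \<gamma> :: real \<Rightarrow> real^'n. 0 < T
    \<and> lipschitz_cont_on {s. t0 \<le> s \<and> ereal s < ereal t0 + T} \<gamma>
    \<and> \<gamma> t0 = x0
    \<and> (\<forall>s. t0 \<le> s \<and> ereal s < ereal t0 + T \<longrightarrow> (s, \<gamma> s) \<in> singular_set (space_time \<Omega>) u)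
    \<and> (T < \<infinity> \<longrightarrow> (\<exists>l \<in> frontier \<Omega>. (\<gamma> \<longlongrightarrow> l) (at_left (t0 + real_of_ereal T))))"
proof -
  interpret quadratic_hamiltonian A by unfold_locales fact
  obtain \<Lambda> where "\<Lambda>-lipschitz_on (closure (space_time \<Omega>)) u"
    using assms(5) unfolding lipschitz_cont_on_def by blast
  then have lip: "\<Lambda>-lipschitz_on (space_time \<Omega>) u" by (rule lipschitz_on_subset) (rule closure_subset)
  have "viscosity_subsolution H (space_time \<Omega>) u" "viscosity_supersolution H (space_time \<Omega>) u"
    using assms(6) by (auto simp: viscosity_solution_def)
  then obtain M where M: "0 < M"
    and arcs: "\<And>t0 R. 0 < t0 \<Longrightarrow> 0 < R \<Longrightarrow> \<exists>T>0. \<forall>t\<ge>t0. \<forall>x. cball x R \<subseteq> \<Omega> \<longrightarrow> (t, x) \<in> singular_set (space_time \<Omega>) u \<longrightarrow>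
      (\<exists>\<gamma>. M-lipschitz_on {t..t + T} \<gamma> \<and> \<gamma> t = x \<and> (\<forall>s\<in>{t..t + T}. (s, \<gamma> s) \<in> singular_set (space_time \<Omega>) u))"
    using uniform_singular_arcs[OF assms(1) _ _ lip] by metis
  have "0 < t0" using assms(8) by (auto simp: singular_set_def space_time_def)
  show ?thesis
  proof (rule maximal_lipschitz_arc[OF assms(1) _ assms(8) M arcs[OF \<open>0 < t0\<close>]])
    fix t x assume "(t, x) \<in> singular_set (space_time \<Omega>) u"
    then show "x \<in> \<Omega>" by (auto simp: singular_set_def space_time_def)
  qed
qed

end
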